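(* Let $w=(w_k)_{k\in\mathbb Z}$ be a bi-infinite word with $w_k\in\{\prec,\prec'\}$ for $k\le0$ and $w_k\in\{\succ,\succ'\}$ for $k\ge1$, and let $(a_i)_{i\ge0}$, $(b_i)_{i\ge0}$ be nonnegative real numbers with $\sum_{i\ge0}(a_i+b_i)<\infty$ and with $a_ib_j<1$ whenever $(w_{-i},w_{j+1})\in\{(\prec,\succ),(\prec',\succ')\}$. Then the output $(\lambda(i))_{i\in\mathbb Z}$ of the randomized algorithm UnboundedSchurSample (described in the context) is distributed as the pyramidal Schur process of word $w$ and parameters $(a_i,b_i)_{i\ge0}$.
   Context: **Partitions.** A partition $\lambda$ is a nonincreasing, eventually zero sequence $\lambda_1\ge\lambda_2\ge\cdots$ of nonnegative integers; $\ell(\lambda)$ is its number of positive parts, $|\lambda|=\sum_i\lambda_i$, $\emptyset$ is the zero partition, $\lambda'$ is the conjugate partition, $\lambda'_i=|\{j:\lambda_j\ge i\}|$. Write $\lambda\succ\mu$ (equivalently $\mu\prec\lambda$) if $\lambda_1\ge\mu_1\ge\lambda_2\ge\mu_2\ge\cdots$, and $\lambda\succ'\mu$ (equivalently $\mu\prec'\lambda$) if $\lambda'\succ\mu'$. **Pyramidal Schur process.** It is the probability measure on bi-infinite sequences of partitions $\Lambda=(\lambda(i))_{i\in\mathbb Z}$ such that $\lambda(k-1)\,w_k\,\lambda(k)$ for all $k\in\mathbb Z$ and $\lambda(i)=\emptyset$ for $|i|$ large enough, obtained by normalizing the weight $$W(\Lambda)=\prod_{i\ge0}a_i^{|\lambda(-i)|-|\lambda(-i-1)|}\prod_{j\ge0}b_j^{|\lambda(j)|-|\lambda(j+1)|}\qquad(0^0=1).$$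 **Random variables.** $Geom(\xi)$, $0\le\xi<1$: $Prob(k)=(1-\xi)\xi^k$, $k=0,1,2,\dots$. $Bernoulli(p)$: value $1$ with probability $p$, value $0$ with probability $1-p$. All random draws in the algorithm are independent. **Atomic steps** (each takes partitions $\lambda,\mu,\kappa$ and a parameter $\xi\ge 0$ and returns a partition $\nu$; convention $\lambda_0=\infty$). - sampleHH$(\lambda,\mu,\kappa,\xi)$: draw $G\sim Geom(\xi)$; return $\nu$ with $\nu_1=\max(\lambda_1,\mu_1)+G$ and $\nu_i=\max(\lambda_i,\mu_i)+\min(\lambda_{i-1},\mu_{i-1})-\kappa_{i-1}$ for $i>1$. - sampleVV$(\lambda,\mu,\kappa,\xi)$: return the conjugate of sampleHH$(\lambda',\mu',\kappa',\xi)$. - sampleHV$(\lambda,\mu,\kappa,\xi)$: draw $B\sim Bernoulli(\xi/(1+\xi))$. For $i=1,\dots,\max(\ell(\lambda),\ell(\mu))+1$ successively: if $\lambda_i\le\mu_i<\lambda_{i-1}$ set $\nu_i=\max(\lambda_i,\mu_i)+B$ with the current value of $B$, else set $\nu_i=\max(\lambda_i,\mu_i)$; then, if $\mu_{i+1}<\lambda_i\le\mu_i$, reassign $B:=\min(\lambda_i,\mu_i)-\kappa_i$. Return $\nu$ (further parts are $0$). - sampleVH$(\lambda,\mu,\kappa,\xi)$ := sampleHV$(\mu,\lambda,\kappa,\xi)$. **Types and constants.** For $i,j\ge0$, the type of $(i,j)$ is HH, VV, HV or VH according to whether $(w_{-i},w_{j+1})$ is $(\prec,\succ)$, $(\prec',\succ')$,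 $(\prec,\succ')$ or $(\prec',\succ)$. Put $c_{i,j}=a_ib_j$ if the type is HH or VV, and $c_{i,j}=a_ib_j/(1+a_ib_j)$ if the type is HV or VH. Let $k(i,j)=(i+j)(i+j+1)/2+j$, a bijection $\mathbb N\times\mathbb N\to\mathbb N$ (with $\mathbb N=\{0,1,2,\dots\}$). **Algorithm UnboundedSchurSample.** 1. Initialize $\tau(i,j)=\emptyset$ for all $i,j\ge0$. 2. Sample $K\in\{-\infty\}\cup\mathbb N$ with $P(K\le k)=\prod_{i,j\ge0,\ k(i,j)>k}(1-c_{i,j})$ for all $k\in\mathbb N$, and $P(K=-\infty)=\prod_{i,j\ge0}(1-c_{i,j})$. 3. If $K=-\infty$, output $\lambda(i)=\emptyset$ for all $i$ and stop. 4. Otherwise let $(i_0,j_0)$ be such that $k(i_0,j_0)=K$, and $n_0=i_0+j_0$. If the type of $(i_0,j_0)$ is HV or VH, set $\tau(i_0,j_0)=(1)$; if it is HH, set $\tau(i_0,j_0)=(1+G)$ (a one-row partition) with $G\sim Geom(a_{i_0}b_{j_0})$; if it is VV, set $\tau(i_0,j_0)=(1+G)'$ (a one-column partition) with $G\sim Geom(a_{i_0}b_{j_0})$. 5. For $n=n_0,n_0-1,\dots,0$ and for $j=0,\dots,n$: skip if $n=n_0$ and $j\ge j_0$; otherwise let $i=n-j$, let $T$ be the type of $(i,j)$, and set $\tau(i,j)=\mathrm{sample}T(\tau(i+1,j),\tau(i,j+1),\tau(i+1,j+1),a_ib_j)$. 6. Output $\lambda(i)=\tau(-i,0)$ for $i<0$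 and $\lambda(i)=\tau(0,i)$ for $i\ge0$. *)

theory Defs
  imports "HOL-Probability.Probability"
begin

(* Parts are indexed from 0: "lam i" is the (i+1)-st part. Hence the convention that the part of
   index 0 is infinite becomes a case distinction on i = 0. *)
type_synonym parts = "nat \<Rightarrow> nat"

definition is_partition :: "parts \<Rightarrow> bool" where
  "is_partition lam \<longleftrightarrow> antimono lam \<and> finite {i. lam i \<noteq> 0}"

definition empty_part :: parts where
  "empty_part = (\<lambda>_. 0)"

definition num_parts :: "parts \<Rightarrow> nat" where
  "num_parts lam = card {i. lam i > 0}"

definition weight :: "parts \<Rightarrow> nat" where
  "weight lam = (\<Sum>i | lam i \<noteq> 0. lam i)"

definition conj_part :: "parts \<Rightarrow> parts" where
  "conj_part lam = (\<lambda>i. card {j. lam j \<ge> Suc i})"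

definition interlaces :: "parts \<Rightarrow> parts \<Rightarrow> bool" (infix "\<succ>\<^sub>h" 50) where
  "lam \<succ>\<^sub>h \<mu> \<longleftrightarrow> (\<forall>i. lam i \<ge> \<mu> i \<and> \<mu> i \<ge> lam (Suc i))"

definition interlaces' :: "parts \<Rightarrow> parts \<Rightarrow> bool" (infix "\<succ>\<^sub>v" 50) where
  "lam \<succ>\<^sub>v \<mu> \<longleftrightarrow> conj_part lam \<succ>\<^sub>h conj_part \<mu>"

datatype letter = Prec | Prec' | Succ | Succ'

fun related :: "letter \<Rightarrow> parts \<Rightarrow> parts \<Rightarrow> bool" where
  "related Prec lam \<mu> \<longleftrightarrow> \<mu> \<succ>\<^sub>h lam"
| "related Prec' lam \<mu> \<longleftrightarrow> \<mu> \<succ>\<^sub>v lam"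
| "related Succ lam \<mu> \<longleftrightarrow> lam \<succ>\<^sub>h \<mu>"
| "related Succ' lam \<mu> \<longleftrightarrow> lam \<succ>\<^sub>v \<mu>"


definition schur_configs :: "(int \<Rightarrow> letter) \<Rightarrow> (int \<Rightarrow> parts) set" where
  "schur_configs w = {\<Lambda>. (\<forall>k. is_partition (\<Lambda> k)) \<and>
     (\<forall>k. related (w k) (\<Lambda> (k - 1)) (\<Lambda> k)) \<and>
     (\<exists>N. \<forall>i. \<bar>i\<bar> > N \<longrightarrow> \<Lambda> i = empty_part)}"

(* On the configurations of a pyramidal word the exponents do not truncate, and all but finitely
   many factors are x ^ 0 = 1. *)
definition schur_weight :: "(nat \<Rightarrow> real) \<Rightarrow> (nat \<Rightarrow> real) \<Rightarrow> (int \<Rightarrow> parts) \<Rightarrow> real" where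
  "schur_weight a b \<Lambda> =
     (\<Prod>i. a i ^ (weight (\<Lambda> (- int i)) - weight (\<Lambda> (- int i - 1)))) *
     (\<Prod>j. b j ^ (weight (\<Lambda> (int j)) - weight (\<Lambda> (int j + 1))))"

definition pyramidal_schur_process ::
    "(int \<Rightarrow> letter) \<Rightarrow> (nat \<Rightarrow> real) \<Rightarrow> (nat \<Rightarrow> real) \<Rightarrow> (int \<Rightarrow> parts) pmf" where
  "pyramidal_schur_process w a b = embed_pmf (\<lambda>\<Lambda>.
     if \<Lambda> \<in> schur_configs w
     then schur_weight a b \<Lambda> / (\<Sum>\<^sub>\<infinity>\<Lambda>\<in>schur_configs w. schur_weight a b \<Lambda>)
     else 0)"


(* geometric_pmf is parametrized by the success probability. *)
abbreviation Geom :: "real \<Rightarrow> nat pmf" where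
  "Geom \<xi> \<equiv> geometric_pmf (1 - \<xi>)"

abbreviation Bernoulli :: "real \<Rightarrow> nat pmf" where
  "Bernoulli p \<equiv> map_pmf of_bool (bernoulli_pmf p)"

(* The subtractions of \<kappa> in the atomic steps do not truncate as long as \<kappa> is contained in both
   lam and \<mu>, which is the case whenever the algorithm calls them. *)
definition sampleHH :: "parts \<Rightarrow> parts \<Rightarrow> parts \<Rightarrow> real \<Rightarrow> parts pmf" where
  "sampleHH lam \<mu> \<kappa> \<xi> = map_pmf (\<lambda>G i. case i of
       0 \<Rightarrow> max (lam 0) (\<mu> 0) + G
     | Suc j \<Rightarrow> max (lam i) (\<mu> i) + (min (lam j) (\<mu> j) - \<kappa> j)) (Geom \<xi>)"

definition sampleVV :: "parts \<Rightarrow> parts \<Rightarrow> parts \<Rightarrow> real \<Rightarrow> parts pmf" where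
  "sampleVV lam \<mu> \<kappa> \<xi> =
     map_pmf conj_part (sampleHH (conj_part lam) (conj_part \<mu>) (conj_part \<kappa>) \<xi>)"

definition stepHV :: "parts \<Rightarrow> parts \<Rightarrow> parts \<Rightarrow> nat \<Rightarrow> parts \<times> nat \<Rightarrow> parts \<times> nat" where
  "stepHV lam \<mu> \<kappa> i = (\<lambda>(\<nu>, B).
     (\<nu>(i := if lam i \<le> \<mu> i \<and> (i = 0 \<or> \<mu> i < lam (i - 1))
             then max (lam i) (\<mu> i) + B else max (lam i) (\<mu> i)),
      if \<mu> (Suc i) < lam i \<and> lam i \<le> \<mu> i then min (lam i) (\<mu> i) - \<kappa> i else B))"

definition sampleHV :: "parts \<Rightarrow> parts \<Rightarrow> parts \<Rightarrow> real \<Rightarrow> parts pmf" where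
  "sampleHV lam \<mu> \<kappa> \<xi> = map_pmf
     (\<lambda>B. fst (fold (stepHV lam \<mu> \<kappa>) [0..<max (num_parts lam) (num_parts \<mu>) + 1] (empty_part, B)))
     (Bernoulli (\<xi> / (1 + \<xi>)))"

definition sampleVH :: "parts \<Rightarrow> parts \<Rightarrow> parts \<Rightarrow> real \<Rightarrow> parts pmf" where
  "sampleVH lam \<mu> \<kappa> \<xi> = sampleHV \<mu> lam \<kappa> \<xi>"


datatype cell_type = HH | VV | HV | VH

definition type_of_cell :: "(int \<Rightarrow> letter) \<Rightarrow> nat \<Rightarrow> nat \<Rightarrow> cell_type" where
  "type_of_cell w i j = (case (w (- int i), w (int j + 1)) of
       (Prec, Succ) \<Rightarrow> HH
     | (Prec', Succ') \<Rightarrow> VV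
     | (Prec, Succ') \<Rightarrow> HV
     | (Prec', Succ) \<Rightarrow> VH
     | _ \<Rightarrow> undefined)"

fun sample :: "cell_type \<Rightarrow> parts \<Rightarrow> parts \<Rightarrow> parts \<Rightarrow> real \<Rightarrow> parts pmf" where
  "sample HH = sampleHH"
| "sample VV = sampleVV"
| "sample HV = sampleHV"
| "sample VH = sampleVH"

definition cell_const ::
    "(int \<Rightarrow> letter) \<Rightarrow> (nat \<Rightarrow> real) \<Rightarrow> (nat \<Rightarrow> real) \<Rightarrow> nat \<times> nat \<Rightarrow> real" where
  "cell_const w a b = (\<lambda>(i, j).
     if type_of_cell w i j \<in> {HH, VV} then a i * b j else a i * b j / (1 + a i * b j))"

definition cell_index :: "nat \<times> nat \<Rightarrow> nat" where
  "cell_index = (\<lambda>(i, j). (i + j) * (i + j + 1) div 2 + j)"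

(* Unordered infinite product, in analogy with infsum. *)
definition infprod :: "('i \<Rightarrow> real) \<Rightarrow> 'i set \<Rightarrow> real" where
  "infprod f A = Lim (finite_subsets_at_top A) (prod f)"

(* The distribution of K, with None standing for minus infinity. *)
definition K_pmf :: "(int \<Rightarrow> letter) \<Rightarrow> (nat \<Rightarrow> real) \<Rightarrow> (nat \<Rightarrow> real) \<Rightarrow> nat option pmf" where
  "K_pmf w a b = (THE p.
     (\<forall>k. measure_pmf.prob p (insert None (Some ` {..k})) =
            infprod (\<lambda>c. 1 - cell_const w a b c) {c. cell_index c > k}) \<and>
     pmf p None = infprod (\<lambda>c. 1 - cell_const w a b c) UNIV)"

definition one_row :: "nat \<Rightarrow> parts" where
  "one_row n = (\<lambda>i. if i = 0 then n else 0)"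

fun sample_first :: "cell_type \<Rightarrow> real \<Rightarrow> parts pmf" where
  "sample_first HH \<xi> = map_pmf (\<lambda>G. one_row (1 + G)) (Geom \<xi>)"
| "sample_first VV \<xi> = map_pmf (\<lambda>G. conj_part (one_row (1 + G))) (Geom \<xi>)"
| "sample_first HV \<xi> = return_pmf (one_row 1)"
| "sample_first VH \<xi> = return_pmf (one_row 1)"

type_synonym array = "nat \<times> nat \<Rightarrow> parts"

definition update_cell ::
    "(int \<Rightarrow> letter) \<Rightarrow> (nat \<Rightarrow> real) \<Rightarrow> (nat \<Rightarrow> real) \<Rightarrow> nat \<times> nat \<Rightarrow> array \<Rightarrow> array pmf" where
  "update_cell w a b = (\<lambda>(i, j) \<tau>. map_pmf (\<lambda>\<nu>. \<tau>((i, j) := \<nu>))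
     (sample (type_of_cell w i j) (\<tau> (i + 1, j)) (\<tau> (i, j + 1)) (\<tau> (i + 1, j + 1)) (a i * b j)))"

primrec update_cells ::
    "(int \<Rightarrow> letter) \<Rightarrow> (nat \<Rightarrow> real) \<Rightarrow> (nat \<Rightarrow> real) \<Rightarrow> (nat \<times> nat) list \<Rightarrow> array \<Rightarrow> array pmf" where
  "update_cells w a b [] \<tau> = return_pmf \<tau>"
| "update_cells w a b (c # cs) \<tau> = bind_pmf (update_cell w a b c \<tau>) (update_cells w a b cs)"

definition cells_after :: "nat \<times> nat \<Rightarrow> (nat \<times> nat) list" where
  "cells_after = (\<lambda>(i0, j0). let n0 = i0 + j0 in
     [(n - j, j). n \<leftarrow> rev [0..<n0 + 1], j \<leftarrow> [0..<n + 1], \<not> (n = n0 \<and> j \<ge> j0)])"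

definition read_output :: "array \<Rightarrow> int \<Rightarrow> parts" where
  "read_output \<tau> = (\<lambda>i. if i < 0 then \<tau> (nat (- i), 0) else \<tau> (0, nat i))"

definition unbounded_schur_sample ::
    "(int \<Rightarrow> letter) \<Rightarrow> (nat \<Rightarrow> real) \<Rightarrow> (nat \<Rightarrow> real) \<Rightarrow> (int \<Rightarrow> parts) pmf" where
  "unbounded_schur_sample w a b = bind_pmf (K_pmf w a b) (\<lambda>K. case K of
       None \<Rightarrow> return_pmf (\<lambda>_. empty_part)
     | Some k \<Rightarrow>
         (let (i0, j0) = inv cell_index k in
          bind_pmf (sample_first (type_of_cell w i0 j0) (a i0 * b j0)) (\<lambda>\<nu>.
          map_pmf read_output
            (update_cells w a b (cells_after (i0, j0)) ((\<lambda>_. empty_part)((i0, j0) := \<nu>))))))"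

end

theory Submission
  imports Defs
begin

text \<open>Read an array of partitions along the boundary of a finite down-set \<open>S\<close> of cells: from row infinity along
the outer border of \<open>S\<close> to column infinity. Crossing from row \<open>i + 1\<close> to row \<open>i\<close> carries the letter \<open>w (-i)\<close>
and the parameter \<open>a i\<close>; crossing from column \<open>j\<close> to column \<open>j + 1\<close> carries \<open>w (j + 1)\<close> and \<open>b j\<close>. For every
\<open>S\<close> this gives a weight on sequences of partitions, and for \<open>S = {}\<close> it is the weight of the pyramidal
Schur process. Sampling the corner cell \<open>(i, j)\<close> of \<open>S\<close> replaces one entry \<open>\<kappa>\<close> of the sequence by \<open>\<nu>\<close>, between
fixed neighbours \<open>lam\<close> and \<open>\<mu>\<close>, and exchanges two adjacent letters of the boundary word.

Each atomic step is a bijection \<open>(\<kappa>, g) \<mapsto> \<nu>\<close> with \<open>|\<nu>| + |\<kappa>| = |lam| + |\<mu>| + g\<close>, where \<open>g\<close> is the random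
draw (\<open>growth_rule_HH\<close>, \<open>growth_rule_VV\<close>, \<open>growth_rule_HV\<close>). The draw \<open>g\<close> has probability
\<open>(1 - c) * (a i * b j) ^ g\<close>, and \<open>(a i * b j) ^ g\<close> is the factor by which the weights differ. Because of the
bijection a given new sequence has only one possible predecessor, so the step turns a law
proportional to the weight for \<open>S\<close> into a law proportional to the weight for \<open>S\<close> without the corner, and
multiplies the constant by \<open>1 - c\<close> (\<open>has_path_law_step\<close>). No summation is involved, and the argument
applies to infinite total mass as well.

Now start from the empty sequence and sample the first \<open>k\<close> cells in decreasing order. The point mass at
the empty sequence is not proportional to the weight for these cells, but the two agree on the
sequences that can lead to a given configuration once \<open>k\<close> is large: going backwards, a configuration
supported on the diagonals \<open>-m, ..., m\<close> only leads to arrays that vanish outside the rows and columns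
up to \<open>m\<close>. Hence the result has probability \<open>(1 - c\<^sub>0) \<cdots> (1 - c\<^sub>k\<^sub>-\<^sub>1)\<close> times the Schur weight
(\<open>seq_chain_law\<close>).

If each of infinitely many cells independently receives a draw, then almost surely only finitely many
draws are nonzero; \<open>K\<close> is the largest index of a nonzero draw and the first sampled partition has
the law of a draw conditioned to be nonzero. Splitting according to whether the draw in cell \<open>k\<close> is zero
(\<open>run_below_Suc\<close>) telescopes the mixture over \<open>K\<close>, so the output law is the limit of the finite runs
(\<open>output_LIMSEQ\<close>), namely the constant \<open>\<Prod>(1 - c)\<close> times the Schur weight. Since a probability law has total
mass 1, the summability of the weights and the value of the partition function follow.\<close>

section \<open>Partitions and interlacing\<close>

lemma down_closed_nat_eq:
  fixes A :: "nat set"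
  assumes "finite A" and "\<And>m n. n \<in> A \<Longrightarrow> m \<le> n \<Longrightarrow> m \<in> A"
  shows "A = {..<card A}"
proof -
  define n where "n = (LEAST m. m \<notin> A)"
  have ex: "\<exists>m. m \<notin> A" using assms(1) ex_new_if_finite infinite_UNIV_nat by blast
  have "n \<notin> A" unfolding n_def using ex by (rule LeastI_ex)
  moreover have "m \<in> A" if "m < n" for m using that not_less_Least unfolding n_def by blast
  ultimately have "A = {..<n}" using assms(2) by (auto simp: not_less) (meson linorder_not_less)
  then show ?thesis by simp
qed

lemma partition_mono: "is_partition lam \<Longrightarrow> i \<le> j \<Longrightarrow> lam j \<le> lam i"
  by (auto simp: is_partition_def dest: antimonoD)

lemma partition_bound:
  assumes "is_partition lam" obtains n where "\<And>i. i \<ge> n \<Longrightarrow> lam i = 0"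
proof -
  obtain n where n: "{i. lam i \<noteq> 0} \<subseteq> {..<n}"
    using assms finite_nat_bounded unfolding is_partition_def by blast
  have "lam i = 0" if "i \<ge> n" for i
    using n that by (cases "lam i = 0") auto
  then show ?thesis by (rule that)
qed

lemma support_subset: "{i. lam i \<noteq> 0} \<subseteq> {..<n}" if "\<And>i. i \<ge> n \<Longrightarrow> lam i = 0" for lam :: parts
proof
  fix i assume "i \<in> {i. lam i \<noteq> 0}"
  then show "i \<in> {..<n}" using that[of i] by (cases "i \<ge> n") auto
qed

lemma is_partitionI:
  assumes "\<And>i. lam (Suc i) \<le> lam i" and "\<And>i. i \<ge> n \<Longrightarrow> lam i = 0"
  shows "is_partition lam"
proof -
  have "antimono lam" using assms(1) by (rule antimonoI[OF lift_Suc_antimono_le])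
  moreover have "{i. lam i \<noteq> 0} \<subseteq> {..<n}" using assms(2) by (rule support_subset)
  ultimately show ?thesis using finite_subset unfolding is_partition_def by blast
qed

lemma is_partition_empty: "is_partition empty_part"
  by (rule is_partitionI) (auto simp: empty_part_def)

lemma weight_eq_sum:
  assumes "\<And>i. i \<ge> n \<Longrightarrow> lam i = 0" shows "weight lam = sum lam {..<n}"
proof -
  have "{i. lam i \<noteq> 0} \<subseteq> {..<n}"
    using assms by (rule support_subset)
  then show ?thesis unfolding weight_def by (intro sum.mono_neutral_left) auto
qed

lemma empty_part_below: "is_partition lam \<Longrightarrow> (\<And>l. lam l \<le> empty_part l) \<Longrightarrow> lam = empty_part"
  by (simp add: empty_part_def fun_eq_iff)

subsection \<open>Conjugation\<close>

text \<open>Both sides say that the cell in row \<open>j\<close> and column \<open>i\<close> belongs to the Young diagram. All facts about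
conjugation are derived from this adjunction.\<close>
lemma conj_part_gt_iff:
  assumes "is_partition lam" shows "j < conj_part lam i \<longleftrightarrow> i < lam j"
proof -
  obtain n where n: "\<And>i. i \<ge> n \<Longrightarrow> lam i = 0" using partition_bound[OF assms] by blast
  have "{j. lam j \<ge> Suc i} \<subseteq> {j. lam j \<noteq> 0}" by auto
  also have "\<dots> \<subseteq> {..<n}" using n by (rule support_subset)
  finally have "finite {j. lam j \<ge> Suc i}" using finite_subset by blast
  then have "{j. lam j \<ge> Suc i} = {..<conj_part lam i}"
    unfolding conj_part_def using partition_mono[OF assms]
    by (intro down_closed_nat_eq) (auto intro: order_trans)
  from arg_cong[OF this, of "\<lambda>A. j \<in> A"] show ?thesis by (simp add: Suc_le_eq)
qed

lemma nat_le_iff_all_less: "(m::nat) \<le> n \<longleftrightarrow> (\<forall>j. j < m \<longrightarrow> j < n)"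
  by (meson leI less_le_trans less_irrefl)

lemma is_partition_conj:
  assumes "is_partition lam" shows "is_partition (conj_part lam)"
proof (rule is_partitionI)
  show "conj_part lam (Suc i) \<le> conj_part lam i" for i
    unfolding nat_le_iff_all_less conj_part_gt_iff[OF assms] using Suc_lessD by blast
  show "conj_part lam i = 0" if "lam 0 \<le> i" for i
    using conj_part_gt_iff[OF assms, of 0 i] that by simp
qed

lemma conj_conj:
  assumes "is_partition lam" shows "conj_part (conj_part lam) = lam"
proof (rule ext, rule antisym)
  fix i
  show "conj_part (conj_part lam) i \<le> lam i" "lam i \<le> conj_part (conj_part lam) i"
    unfolding nat_le_iff_all_less conj_part_gt_iff[OF assms]
      conj_part_gt_iff[OF is_partition_conj[OF assms]] by simp_all
qed

lemma weight_card:
  assumes "is_partition lam" shows "weight lam = card {(i, j). j < lam i}"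
proof -
  have fin: "finite {i. lam i \<noteq> 0}" using assms by (simp add: is_partition_def)
  have "{(i, j). j < lam i} = (SIGMA i:{i. lam i \<noteq> 0}. {..<lam i})" by auto
  then show ?thesis using fin by (simp add: weight_def)
qed

lemma weight_conj:
  assumes "is_partition lam" shows "weight (conj_part lam) = weight lam"
proof -
  have "bij_betw prod.swap {(i, j). j < conj_part lam i} {(i, j). j < lam i}"
    by (rule bij_betwI[where g = prod.swap]) (auto simp: conj_part_gt_iff[OF assms])
  then show ?thesis
    by (simp add: weight_card assms is_partition_conj bij_betw_same_card)
qed

lemma interlaces'_iff:
  assumes "is_partition lam" "is_partition \<mu>"
  shows "lam \<succ>\<^sub>v \<mu> \<longleftrightarrow> (\<forall>i. \<mu> i \<le> lam i \<and> lam i \<le> Suc (\<mu> i))"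
proof -
  have "lam \<succ>\<^sub>v \<mu> \<longleftrightarrow> (\<forall>i j. (i < \<mu> j \<longrightarrow> i < lam j) \<and> (Suc i < lam j \<longrightarrow> i < \<mu> j))"
    unfolding interlaces'_def interlaces_def nat_le_iff_all_less conj_part_gt_iff[OF assms(1)]
      conj_part_gt_iff[OF assms(2)] by blast
  also have "\<dots> \<longleftrightarrow> (\<forall>j. \<mu> j \<le> lam j \<and> lam j \<le> Suc (\<mu> j))"
  proof (intro iffI allI conjI impI)
    fix j assume *: "\<forall>i j. (i < \<mu> j \<longrightarrow> i < lam j) \<and> (Suc i < lam j \<longrightarrow> i < \<mu> j)"
    show "\<mu> j \<le> lam j" using * unfolding nat_le_iff_all_less by blast
    show "lam j \<le> Suc (\<mu> j)" using *[rule_format, of "\<mu> j" j] by simp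
  next
    fix i j assume *: "\<forall>j. \<mu> j \<le> lam j \<and> lam j \<le> Suc (\<mu> j)"
    show "i < lam j" if "i < \<mu> j" using * that by (meson less_le_trans)
    show "i < \<mu> j" if "Suc i < lam j" using * that by (meson Suc_less_eq less_le_trans)
  qed
  finally show ?thesis .
qed

lemma conj_empty: "conj_part empty_part = empty_part"
  by (simp add: conj_part_def empty_part_def)

section \<open>The atomic steps as bijections\<close>

text \<open>The partitions that can complete \<open>lam\<close> and \<open>\<mu>\<close> to the lower corner of a square, respectively to its upper
corner. \<open>L\<close> is the relation along a row step and \<open>R\<close> the relation along a column step.\<close>
definition lower_corners where
  "lower_corners L R lam \<mu> = {\<kappa>. is_partition \<kappa> \<and> L \<mu> \<kappa> \<and> R lam \<kappa>}"

definition upper_corners where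
  "upper_corners L R lam \<mu> = {\<nu>. is_partition \<nu> \<and> L \<nu> lam \<and> R \<nu> \<mu>}"

text \<open>What the sampling argument needs of an atomic step: for fixed neighbours the lower corner and the draw
together determine the upper corner, reversibly, and the draw accounts for the change of size.\<close>
definition growth_rule ::
    "(parts \<Rightarrow> parts \<Rightarrow> bool) \<Rightarrow> (parts \<Rightarrow> parts \<Rightarrow> bool) \<Rightarrow> nat set \<Rightarrow>
     (parts \<Rightarrow> parts \<Rightarrow> parts \<Rightarrow> nat \<Rightarrow> parts) \<Rightarrow> bool" where
  "growth_rule L R G U \<longleftrightarrow> (\<forall>lam \<mu>. is_partition lam \<longrightarrow> is_partition \<mu> \<longrightarrow>
     bij_betw (\<lambda>(\<kappa>, g). U lam \<mu> \<kappa> g) (lower_corners L R lam \<mu> \<times> G) (upper_corners L R lam \<mu>) \<and>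
     (\<forall>\<kappa>\<in>lower_corners L R lam \<mu>. \<forall>g\<in>G.
        weight (U lam \<mu> \<kappa> g) + weight \<kappa> = weight lam + weight \<mu> + g))"

subsection \<open>The rule HH\<close>

definition growHH :: "parts \<Rightarrow> parts \<Rightarrow> parts \<Rightarrow> nat \<Rightarrow> parts" where
  "growHH lam \<mu> \<kappa> g = (\<lambda>i. case i of
       0 \<Rightarrow> max (lam 0) (\<mu> 0) + g
     | Suc j \<Rightarrow> max (lam i) (\<mu> i) + (min (lam j) (\<mu> j) - \<kappa> j))"

lemma sampleHH_eq: "sampleHH lam \<mu> \<kappa> \<xi> = map_pmf (growHH lam \<mu> \<kappa>) (Geom \<xi>)"
  by (simp add: sampleHH_def growHH_def[abs_def])

text \<open>For \<open>i > 0\<close> the part \<open>\<nu> i\<close> and the part \<open>\<kappa> (i - 1)\<close> range over the same interval, from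
\<open>max (lam i) (\<mu> i)\<close> to \<open>min (lam (i - 1)) (\<mu> (i - 1))\<close>; the rule reflects this interval. The part \<open>\<nu> 0\<close> is
unbounded above and is parametrized by \<open>g\<close>.\<close>
lemma growth_rule_HH: "growth_rule (\<succ>\<^sub>h) (\<succ>\<^sub>h) UNIV growHH"
  unfolding growth_rule_def
proof (intro allI impI conjI ballI)
  fix lam \<mu> assume part: "is_partition lam" "is_partition \<mu>"
  obtain n1 where n1: "\<And>i. i \<ge> n1 \<Longrightarrow> lam i = 0" using partition_bound[OF part(1)] by blast
  obtain n2 where n2: "\<And>i. i \<ge> n2 \<Longrightarrow> \<mu> i = 0" using partition_bound[OF part(2)] by blast
  define n where "n = max n1 n2"
  have n: "lam i = 0" "\<mu> i = 0" if "i \<ge> n" for i using n1 n2 that by (auto simp: n_def)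
  define B where "B = lower_corners (\<succ>\<^sub>h) (\<succ>\<^sub>h) lam \<mu>"
  define A where "A = upper_corners (\<succ>\<^sub>h) (\<succ>\<^sub>h) lam \<mu>"
  define inverse where "inverse = (\<lambda>\<nu>. (\<lambda>i. max (lam (Suc i)) (\<mu> (Suc i)) + min (lam i) (\<mu> i) - \<nu> (Suc i),
      \<nu> 0 - max (lam 0) (\<mu> 0)))"
  have B: "\<kappa> i \<le> lam i" "\<kappa> i \<le> \<mu> i" "lam (Suc i) \<le> \<kappa> i" "\<mu> (Suc i) \<le> \<kappa> i" if "\<kappa> \<in> B" for \<kappa> i
    using that by (auto simp: B_def lower_corners_def interlaces_def)
  have A: "\<nu> (Suc i) \<le> lam i" "\<nu> (Suc i) \<le> \<mu> i" "lam i \<le> \<nu> i" "\<mu> i \<le> \<nu> i" if "\<nu> \<in> A" for \<nu> i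
    using that by (auto simp: A_def upper_corners_def interlaces_def)
  have "bij_betw (\<lambda>(\<kappa>, g). growHH lam \<mu> \<kappa> g) (B \<times> UNIV) A"
  proof (rule bij_betw_byWitness[where f' = inverse])
    show "\<forall>x\<in>B \<times> UNIV. inverse (case x of (\<kappa>, g) \<Rightarrow> growHH lam \<mu> \<kappa> g) = x"
    proof (rule ballI, clarify)
      fix \<kappa> and g :: nat assume \<kappa>: "\<kappa> \<in> B"
      have "max (lam (Suc i)) (\<mu> (Suc i)) + min (lam i) (\<mu> i) -
          (max (lam (Suc i)) (\<mu> (Suc i)) + (min (lam i) (\<mu> i) - \<kappa> i)) = \<kappa> i" for i
        using B[OF \<kappa>, of i] by simp
      then show "inverse (growHH lam \<mu> \<kappa> g) = (\<kappa>, g)"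
        by (simp add: inverse_def growHH_def)
    qed
    show "\<forall>\<nu>\<in>A. (case inverse \<nu> of (\<kappa>, g) \<Rightarrow> growHH lam \<mu> \<kappa> g) = \<nu>"
    proof (intro ballI ext)
      fix \<nu> i assume "\<nu> \<in> A"
      then show "(case inverse \<nu> of (\<kappa>, g) \<Rightarrow> growHH lam \<mu> \<kappa> g) i = \<nu> i"
        using A[of \<nu> "i - 1"] A[of \<nu> i] by (cases i) (auto simp: inverse_def growHH_def)
    qed
    show "(\<lambda>(\<kappa>, g). growHH lam \<mu> \<kappa> g) ` (B \<times> UNIV) \<subseteq> A"
    proof clarsimp
      fix \<kappa> g assume "\<kappa> \<in> B"
      have lower: "max (lam i) (\<mu> i) \<le> growHH lam \<mu> \<kappa> g i" for i
        by (cases i) (auto simp: growHH_def max_def)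
      have upper: "growHH lam \<mu> \<kappa> g (Suc i) \<le> min (lam i) (\<mu> i)" for i
        using B[OF \<open>\<kappa> \<in> B\<close>, of i] by (auto simp: growHH_def max_def min_def)
      have "is_partition (growHH lam \<mu> \<kappa> g)"
      proof (rule is_partitionI)
        show "growHH lam \<mu> \<kappa> g (Suc i) \<le> growHH lam \<mu> \<kappa> g i" for i
          using lower[of i] upper[of i] by simp
        show "growHH lam \<mu> \<kappa> g i = 0" if "i \<ge> Suc n" for i
          using upper[of "i - 1"] n[of "i - 1"] that by (cases i) auto
      qed
      then show "growHH lam \<mu> \<kappa> g \<in> A"
        using lower upper by (auto simp: A_def upper_corners_def interlaces_def)
    qed
    show "inverse ` A \<subseteq> B \<times> UNIV"
    proof (rule image_subsetI)
      fix \<nu> assume "\<nu> \<in> A"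
      define \<kappa> where "\<kappa> = fst (inverse \<nu>)"
      have \<kappa>: "\<kappa> i = max (lam (Suc i)) (\<mu> (Suc i)) + min (lam i) (\<mu> i) - \<nu> (Suc i)" for i
        by (simp add: \<kappa>_def inverse_def)
      have lower: "max (lam (Suc i)) (\<mu> (Suc i)) \<le> \<kappa> i" for i
        using A[OF \<open>\<nu> \<in> A\<close>, of i] unfolding \<kappa> by (auto simp: max_def min_def)
      have upper: "\<kappa> i \<le> min (lam i) (\<mu> i)" for i
        using A[OF \<open>\<nu> \<in> A\<close>, of "Suc i"] unfolding \<kappa> by (auto simp: max_def min_def)
      have "is_partition \<kappa>"
      proof (rule is_partitionI)
        show "\<kappa> (Suc i) \<le> \<kappa> i" for i
          using lower[of i] upper[of "Suc i"] by simp
        show "\<kappa> i = 0" if "i \<ge> n" for i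
          using upper[of i] n[of i] that by simp
      qed
      then have "\<kappa> \<in> B"
        using lower upper by (auto simp: B_def lower_corners_def interlaces_def)
      then show "inverse \<nu> \<in> B \<times> UNIV" by (simp add: \<kappa>_def mem_Times_iff)
    qed
  qed
  then show "bij_betw (\<lambda>(\<kappa>, g). growHH lam \<mu> \<kappa> g)
      (lower_corners (\<succ>\<^sub>h) (\<succ>\<^sub>h) lam \<mu> \<times> UNIV) (upper_corners (\<succ>\<^sub>h) (\<succ>\<^sub>h) lam \<mu>)"
    by (simp add: A_def B_def)
  fix \<kappa> g assume "\<kappa> \<in> lower_corners (\<succ>\<^sub>h) (\<succ>\<^sub>h) lam \<mu>"
  then have \<kappa>: "\<kappa> \<in> B" by (simp add: B_def)
  let ?\<nu> = "growHH lam \<mu> \<kappa> g"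
  have "\<kappa> i = 0" if "i \<ge> n" for i using B[OF \<kappa>, of i] n[OF that] by simp
  then have w\<kappa>: "weight \<kappa> = sum \<kappa> {..<n}" by (rule weight_eq_sum)
  have "?\<nu> i = 0" if "i \<ge> Suc n" for i
    using that n[of "i - 1"] n[of i] by (cases i) (auto simp: growHH_def)
  then have "weight ?\<nu> = sum ?\<nu> {..<Suc n}" by (rule weight_eq_sum)
  also have "\<dots> = ?\<nu> 0 + (\<Sum>i<n. ?\<nu> (Suc i))" by (rule sum.lessThan_Suc_shift)
  finally have "weight ?\<nu> + weight \<kappa> = ?\<nu> 0 + (\<Sum>i<n. ?\<nu> (Suc i) + \<kappa> i)"
    by (simp add: w\<kappa> sum.distrib)
  also have "(\<Sum>i<n. ?\<nu> (Suc i) + \<kappa> i) =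
      (\<Sum>i<n. max (lam (Suc i)) (\<mu> (Suc i)) + min (lam i) (\<mu> i))"
  proof (rule sum.cong[OF refl])
    fix i show "?\<nu> (Suc i) + \<kappa> i = max (lam (Suc i)) (\<mu> (Suc i)) + min (lam i) (\<mu> i)"
      using B[OF \<kappa>, of i] by (simp add: growHH_def)
  qed
  also have "?\<nu> 0 + \<dots> = g + (\<Sum>i<Suc n. max (lam i) (\<mu> i)) + (\<Sum>i<n. min (lam i) (\<mu> i))"
    unfolding sum.lessThan_Suc_shift by (simp add: sum.distrib growHH_def)
  also have "\<dots> = g + (\<Sum>i<n. max (lam i) (\<mu> i) + min (lam i) (\<mu> i))"
    by (simp add: n sum.distrib)
  also have "(\<Sum>i<n. max (lam i) (\<mu> i) + min (lam i) (\<mu> i)) = (\<Sum>i<n. lam i + \<mu> i)"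
    by (intro sum.cong) auto
  also have "\<dots> = weight lam + weight \<mu>"
    using weight_eq_sum[of n lam] weight_eq_sum[of n \<mu>] n by (simp add: sum.distrib)
  finally show "weight ?\<nu> + weight \<kappa> = weight lam + weight \<mu> + g" by simp
qed

subsection \<open>The rule VV\<close>

definition growVV :: "parts \<Rightarrow> parts \<Rightarrow> parts \<Rightarrow> nat \<Rightarrow> parts" where
  "growVV lam \<mu> \<kappa> g = conj_part (growHH (conj_part lam) (conj_part \<mu>) (conj_part \<kappa>) g)"

lemma sampleVV_eq: "sampleVV lam \<mu> \<kappa> \<xi> = map_pmf (growVV lam \<mu> \<kappa>) (Geom \<xi>)"
  by (simp add: sampleVV_def sampleHH_eq map_pmf_comp growVV_def[abs_def])

lemma bij_betw_conj:
  "bij_betw conj_part {lam. is_partition lam \<and> P (conj_part lam)} {lam. is_partition lam \<and> P lam}"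
  by (rule bij_betwI[where g = conj_part]) (auto simp: is_partition_conj conj_conj)

text \<open>Conjugation exchanges the two interlacing relations, preserves sizes, and is an involution, so this is
the rule HH in other coordinates.\<close>
lemma growth_rule_VV: "growth_rule (\<succ>\<^sub>v) (\<succ>\<^sub>v) UNIV growVV"
  unfolding growth_rule_def
proof (intro allI impI conjI ballI)
  fix lam \<mu> assume part: "is_partition lam" "is_partition \<mu>"
  let ?lam = "conj_part lam" and ?\<mu> = "conj_part \<mu>"
  note part' = part[THEN is_partition_conj]
  have HH: "bij_betw (\<lambda>(\<kappa>, g). growHH ?lam ?\<mu> \<kappa> g)
      (lower_corners (\<succ>\<^sub>h) (\<succ>\<^sub>h) ?lam ?\<mu> \<times> UNIV) (upper_corners (\<succ>\<^sub>h) (\<succ>\<^sub>h) ?lam ?\<mu>)"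
    using growth_rule_HH part' unfolding growth_rule_def by blast
  have down: "bij_betw conj_part (lower_corners (\<succ>\<^sub>v) (\<succ>\<^sub>v) lam \<mu>) (lower_corners (\<succ>\<^sub>h) (\<succ>\<^sub>h) ?lam ?\<mu>)"
    unfolding lower_corners_def interlaces'_def by (rule bij_betw_conj)
  have up: "bij_betw conj_part (upper_corners (\<succ>\<^sub>h) (\<succ>\<^sub>h) ?lam ?\<mu>) (upper_corners (\<succ>\<^sub>v) (\<succ>\<^sub>v) lam \<mu>)"
    using bij_betw_conj[of "\<lambda>\<nu>. conj_part \<nu> \<succ>\<^sub>h ?lam \<and> conj_part \<nu> \<succ>\<^sub>h ?\<mu>"]
    by (simp add: upper_corners_def interlaces'_def conj_conj cong: conj_cong)
  have "bij_betw (conj_part \<circ> (\<lambda>(\<kappa>, g). growHH ?lam ?\<mu> \<kappa> g) \<circ> map_prod conj_part id)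
      (lower_corners (\<succ>\<^sub>v) (\<succ>\<^sub>v) lam \<mu> \<times> UNIV) (upper_corners (\<succ>\<^sub>v) (\<succ>\<^sub>v) lam \<mu>)"
    by (intro bij_betw_trans[OF _ bij_betw_trans[OF HH up, unfolded comp_def], unfolded comp_def]
          bij_betw_trans[OF bij_betw_map_prod[OF down bij_betw_id] bij_betw_trans[OF HH up]])
  then show "bij_betw (\<lambda>(\<kappa>, g). growVV lam \<mu> \<kappa> g)
      (lower_corners (\<succ>\<^sub>v) (\<succ>\<^sub>v) lam \<mu> \<times> UNIV) (upper_corners (\<succ>\<^sub>v) (\<succ>\<^sub>v) lam \<mu>)"
    by (simp add: growVV_def comp_def case_prod_unfold)
  fix \<kappa> and g :: nat assume \<kappa>: "\<kappa> \<in> lower_corners (\<succ>\<^sub>v) (\<succ>\<^sub>v) lam \<mu>"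
  then have \<kappa>': "conj_part \<kappa> \<in> lower_corners (\<succ>\<^sub>h) (\<succ>\<^sub>h) ?lam ?\<mu>"
    using down by (auto simp: bij_betw_def)
  then have "growHH ?lam ?\<mu> (conj_part \<kappa>) g \<in> upper_corners (\<succ>\<^sub>h) (\<succ>\<^sub>h) ?lam ?\<mu>"
    using bij_betwE[OF HH] by fastforce
  then have "is_partition (growHH ?lam ?\<mu> (conj_part \<kappa>) g)" by (simp add: upper_corners_def)
  moreover have "weight (growHH ?lam ?\<mu> (conj_part \<kappa>) g) + weight (conj_part \<kappa>) =
      weight ?lam + weight ?\<mu> + g"
    using growth_rule_HH part' \<kappa>' unfolding growth_rule_def by blast
  ultimately show "weight (growVV lam \<mu> \<kappa> g) + weight \<kappa> = weight lam + weight \<mu> + g"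
    using \<kappa> part by (simp add: growVV_def weight_conj lower_corners_def)
qed

subsection \<open>The rules HV and VH\<close>

text \<open>In the situation of HV, with \<open>lam\<close> and \<open>\<mu>\<close> having at least one lower or upper corner, each part of \<open>\<kappa>\<close> and
of \<open>\<nu>\<close> is either forced or has exactly two possible values. The part \<open>\<nu> i\<close> is free iff
\<open>slot i\<close> and \<open>lam i \<le> \<mu> i\<close>; the part \<open>\<kappa> i\<close> is free iff \<open>lam i \<le> \<mu> i\<close> and \<open>slot (Suc i)\<close>. Free parts of \<open>\<nu>\<close> and
of \<open>\<kappa>\<close> alternate, beginning and ending with one of \<open>\<nu>\<close>, so the bits of \<open>\<kappa>\<close>, preceded by the drawn bit, can
be handed on in order: \<open>carry i\<close> is the bit held by the algorithm when it reaches row \<open>i\<close>.\<close>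
primrec carry :: "parts \<Rightarrow> parts \<Rightarrow> parts \<Rightarrow> nat \<Rightarrow> nat \<Rightarrow> nat" where
  "carry lam \<mu> \<kappa> B 0 = B"
| "carry lam \<mu> \<kappa> B (Suc i) =
     (if \<mu> (Suc i) < lam i \<and> lam i \<le> \<mu> i then min (lam i) (\<mu> i) - \<kappa> i else carry lam \<mu> \<kappa> B i)"

definition slot :: "parts \<Rightarrow> parts \<Rightarrow> nat \<Rightarrow> bool" where
  "slot lam \<mu> i \<longleftrightarrow> i = 0 \<or> \<mu> i < lam (i - 1)"

text \<open>In this situation, if \<open>slot i\<close> fails, the bit held by the algorithm has already been written into \<open>\<nu>\<close>. Replacing
it by 0 makes the number of bits a conserved quantity.\<close>
definition live_carry :: "parts \<Rightarrow> parts \<Rightarrow> parts \<Rightarrow> nat \<Rightarrow> nat \<Rightarrow> nat" where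
  "live_carry lam \<mu> \<kappa> B i = (if slot lam \<mu> i then carry lam \<mu> \<kappa> B i else 0)"

definition growHV :: "parts \<Rightarrow> parts \<Rightarrow> parts \<Rightarrow> nat \<Rightarrow> parts" where
  "growHV lam \<mu> \<kappa> B = (\<lambda>i. max (lam i) (\<mu> i) + (if lam i \<le> \<mu> i then live_carry lam \<mu> \<kappa> B i else 0))"

lemma fold_stepHV:
  "fold (stepHV lam \<mu> \<kappa>) [0..<n] (empty_part, B) =
     (\<lambda>i. if i < n then growHV lam \<mu> \<kappa> B i else 0, carry lam \<mu> \<kappa> B n)"
proof (induction n)
  case 0
  then show ?case by (simp add: empty_part_def)
next
  case (Suc n)
  then show ?case
    by (auto simp: stepHV_def fun_eq_iff growHV_def live_carry_def slot_def less_Suc_eq)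
qed

lemma num_parts_bound:
  assumes "is_partition lam" "num_parts lam \<le> i" shows "lam i = 0"
proof -
  have "{i. lam i > 0} = {..<num_parts lam}"
    unfolding num_parts_def
  proof (rule down_closed_nat_eq)
    show "finite {i. lam i > 0}" using assms(1) by (simp add: is_partition_def)
    show "m \<in> {i. lam i > 0}" if "n \<in> {i. lam i > 0}" "m \<le> n" for m n
      using partition_mono[OF assms(1) that(2)] that(1) by simp
  qed
  from arg_cong[OF this, of "\<lambda>A. i \<in> A"] show ?thesis using assms(2) by simp
qed

lemma sampleHV_eq:
  assumes "is_partition lam" "is_partition \<mu>"
  shows "sampleHV lam \<mu> \<kappa> \<xi> = map_pmf (growHV lam \<mu> \<kappa>) (Bernoulli (\<xi> / (1 + \<xi>)))"
  unfolding sampleHV_def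
proof (rule map_pmf_cong[OF refl])
  fix B
  let ?n = "max (num_parts lam) (num_parts \<mu>) + 1"
  have "growHV lam \<mu> \<kappa> B i = 0" if "\<not> i < ?n" for i
  proof -
    have "lam i = 0" "\<mu> i = 0" "lam (i - 1) = 0" "i \<noteq> 0"
      using that num_parts_bound[OF assms(1), of i] num_parts_bound[OF assms(2), of i]
        num_parts_bound[OF assms(1), of "i - 1"] by auto
    then show ?thesis by (simp add: growHV_def live_carry_def slot_def)
  qed
  then show "fst (fold (stepHV lam \<mu> \<kappa>) [0..<?n] (empty_part, B)) = growHV lam \<mu> \<kappa> B"
    unfolding fold_stepHV by (auto simp: fun_eq_iff)
qed

text \<open>The live bit at row \<open>i\<close> recovered from \<open>\<nu>\<close>: it is the one that ends up in the next free part of \<open>\<nu>\<close>, which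
lies in the first row \<open>m \<ge> i\<close> with \<open>lam m \<le> \<mu> m\<close>.\<close>
definition next_carry :: "parts \<Rightarrow> parts \<Rightarrow> parts \<Rightarrow> nat \<Rightarrow> nat" where
  "next_carry lam \<mu> \<nu> i = (if slot lam \<mu> i
     then let m = LEAST m. i \<le> m \<and> lam m \<le> \<mu> m in \<nu> m - max (lam m) (\<mu> m) else 0)"

lemma slot_Suc:
  assumes "is_partition \<mu>" "\<not> lam i \<le> \<mu> i" shows "slot lam \<mu> (Suc i)"
  using assms partition_mono[OF assms(1), of i "Suc i"] by (simp add: slot_def)

lemma next_carry_eq:
  assumes "is_partition \<mu>"
  shows "next_carry lam \<mu> \<nu> i = (if slot lam \<mu> i
     then if lam i \<le> \<mu> i then \<nu> i - max (lam i) (\<mu> i) else next_carry lam \<mu> \<nu> (Suc i) else 0)"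
proof (cases "lam i \<le> \<mu> i")
  case True
  then have "(LEAST m. i \<le> m \<and> lam m \<le> \<mu> m) = i" by (intro Least_equality) auto
  then show ?thesis using True by (simp add: next_carry_def)
next
  case False
  then have "(i \<le> m \<and> lam m \<le> \<mu> m) = (Suc i \<le> m \<and> lam m \<le> \<mu> m)" for m
    by (metis Suc_leD not_less_eq_eq le_antisym)
  then show ?thesis using False slot_Suc[of \<mu> lam i, OF assms False] by (simp add: next_carry_def)
qed

text \<open>The inverse map reads the bits off \<open>\<nu>\<close> with \<open>next_carry\<close> and moves each of them back to the preceding
free part of \<open>\<kappa>\<close>, or into \<open>g\<close> for the first one. The size identity is the conservation of bits,
row by row.\<close>
lemma growth_rule_HV: "growth_rule (\<succ>\<^sub>h) (\<succ>\<^sub>v) {0, 1} growHV"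
  unfolding growth_rule_def
proof (intro allI impI conjI ballI)
  fix lam \<mu> assume part: "is_partition lam" "is_partition \<mu>"
  obtain n1 where n1: "\<And>i. i \<ge> n1 \<Longrightarrow> lam i = 0" using partition_bound[OF part(1)] by blast
  obtain n2 where n2: "\<And>i. i \<ge> n2 \<Longrightarrow> \<mu> i = 0" using partition_bound[OF part(2)] by blast
  \<comment> \<open>One more than needed for the parts to vanish, so that \<open>slot\<close> fails from \<open>n\<close> on.\<close>
  define n where "n = Suc (max n1 n2)"
  have n: "lam i = 0" "\<mu> i = 0" "lam (i - 1) = 0" "i \<noteq> 0" if "i \<ge> n" for i
    using n1[of i] n2[of i] n1[of "i - 1"] that by (auto simp: n_def)
  let ?s = "\<lambda>i. lam i \<le> \<mu> i" and ?t = "slot lam \<mu>" and ?C = "live_carry lam \<mu>"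
  define B where "B = lower_corners (\<succ>\<^sub>h) (\<succ>\<^sub>v) lam \<mu>"
  define A where "A = upper_corners (\<succ>\<^sub>h) (\<succ>\<^sub>v) lam \<mu>"
  define inverse where "inverse = (\<lambda>\<nu>.
      (\<lambda>i. min (lam i) (\<mu> i) - (if ?s i \<and> ?t (Suc i) then next_carry lam \<mu> \<nu> (Suc i) else 0),
       next_carry lam \<mu> \<nu> 0))"
  have t0: "?t 0" by (simp add: slot_def)
  have tS: "?t (Suc i) \<longleftrightarrow> \<mu> (Suc i) < lam i" for i by (simp add: slot_def)
  have ts: "?t i" if "\<not> ?s i" for i
    using that partition_mono[OF part(1), of "i - 1" i] by (auto simp: slot_def)
  have B: "\<kappa> i \<le> lam i" "\<kappa> i \<le> \<mu> i" "lam i \<le> Suc (\<kappa> i)" "\<mu> (Suc i) \<le> \<kappa> i" if "\<kappa> \<in> B" for \<kappa> i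
    using that part by (auto simp: B_def lower_corners_def interlaces_def interlaces'_iff)
  have A: "\<nu> (Suc i) \<le> lam i" "lam i \<le> \<nu> i" "\<mu> i \<le> \<nu> i" "\<nu> i \<le> Suc (\<mu> i)" if "\<nu> \<in> A" for \<nu> i
    using that part by (auto simp: A_def upper_corners_def interlaces_def interlaces'_iff)
  have C_0: "?C \<kappa> g 0 = g" for \<kappa> g using t0 by (simp add: live_carry_def)
  have C_Suc: "?C \<kappa> g (Suc i) = (if ?t (Suc i)
      then if ?s i then min (lam i) (\<mu> i) - \<kappa> i else ?C \<kappa> g i else 0)" for \<kappa> g i
    using ts[of i] tS[of i] by (auto simp: live_carry_def)
  have C_le: "?C \<kappa> g i \<le> 1" if "\<kappa> \<in> B" "g \<in> {0, 1}" for \<kappa> g i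
  proof (induction i)
    case 0 then show ?case using that(2) C_0 by auto
  next
    case (Suc i) then show ?case using B[OF that(1), of i] by (auto simp: C_Suc)
  qed
  have nonfree: "\<kappa> i = min (lam i) (\<mu> i)" if "\<kappa> \<in> B" "\<not> (?s i \<and> ?t (Suc i))" for \<kappa> i
    using that(2) B[OF that(1), of i] tS[of i] by auto
  \<comment> \<open>Downward induction from \<open>n\<close>, where both sides are 0.\<close>
  have D_eq: "next_carry lam \<mu> (growHV lam \<mu> \<kappa> g) i = ?C \<kappa> g i" for \<kappa> g i
  proof (induction "n - i" arbitrary: i)
    case 0
    then have "\<not> ?t i" using n[of i] by (simp add: slot_def)
    then show ?case by (simp add: next_carry_def live_carry_def)
  next
    case (Suc k)
    then have "next_carry lam \<mu> (growHV lam \<mu> \<kappa> g) (Suc i) = ?C \<kappa> g (Suc i)" by simp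
    then show ?case using slot_Suc[OF part(2), of lam i]
      unfolding next_carry_eq[OF part(2), of lam _ i]
      by (auto simp: growHV_def C_Suc) (auto simp: live_carry_def)
  qed
  have "bij_betw (\<lambda>(\<kappa>, g). growHV lam \<mu> \<kappa> g) (B \<times> {0, 1}) A"
  proof (rule bij_betw_byWitness[where f' = inverse])
    show "\<forall>x\<in>B \<times> {0, 1}. inverse (case x of (\<kappa>, g) \<Rightarrow> growHV lam \<mu> \<kappa> g) = x"
    proof (rule ballI, clarify)
      fix \<kappa> g assume \<kappa>: "\<kappa> \<in> B"
      have "min (lam i) (\<mu> i) - (if ?s i \<and> ?t (Suc i) then ?C \<kappa> g (Suc i) else 0) = \<kappa> i" for i
        using B[OF \<kappa>, of i] nonfree[OF \<kappa>, of i] by (auto simp: C_Suc)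
      then show "inverse (growHV lam \<mu> \<kappa> g) = (\<kappa>, g)"
        by (simp add: inverse_def D_eq C_0 cong: if_cong)
    qed
    show "(\<lambda>(\<kappa>, g). growHV lam \<mu> \<kappa> g) ` (B \<times> {0, 1}) \<subseteq> A"
    proof (rule subsetI, clarify)
      fix \<kappa> g assume \<kappa>: "\<kappa> \<in> B" and g: "g \<in> {0, 1::nat}"
      let ?\<nu> = "growHV lam \<mu> \<kappa> g"
      have lower: "max (lam i) (\<mu> i) \<le> ?\<nu> i" for i by (simp add: growHV_def)
      have upper: "?\<nu> i \<le> Suc (\<mu> i)" for i
        using C_le[OF \<kappa> g, of i] B[OF \<kappa>, of i] by (auto simp: growHV_def)
      have left: "?\<nu> (Suc i) \<le> lam i" for i
        using C_le[OF \<kappa> g, of "Suc i"] B[OF \<kappa>, of i] tS[of i] partition_mono[OF part(1), of i "Suc i"]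
        by (auto simp: growHV_def live_carry_def)
      have "is_partition ?\<nu>"
      proof (rule is_partitionI)
        show "?\<nu> (Suc i) \<le> ?\<nu> i" for i using lower[of i] left[of i] by simp
        show "?\<nu> i = 0" if "i \<ge> n" for i using left[of "i - 1"] n[OF that] by simp
      qed
      then show "?\<nu> \<in> A"
        using lower upper left part by (auto simp: A_def upper_corners_def interlaces_def interlaces'_iff)
    qed
    have D_le: "next_carry lam \<mu> \<nu> i \<le> 1" if "\<nu> \<in> A" for \<nu> i
    proof -
      have "\<nu> m - max (lam m) (\<mu> m) \<le> 1" for m using A[OF that, of m] by simp
      then show ?thesis by (simp add: next_carry_def Let_def)
    qed
    show "inverse ` A \<subseteq> B \<times> {0, 1}"
    proof (rule image_subsetI)
      fix \<nu> assume \<nu>: "\<nu> \<in> A"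
      define \<kappa> where "\<kappa> = fst (inverse \<nu>)"
      have \<kappa>: "\<kappa> i = min (lam i) (\<mu> i) -
          (if ?s i \<and> ?t (Suc i) then next_carry lam \<mu> \<nu> (Suc i) else 0)" for i
        by (simp add: \<kappa>_def inverse_def)
      have upper: "\<kappa> i \<le> min (lam i) (\<mu> i)" for i unfolding \<kappa> by (rule diff_le_self)
      have lower: "lam i \<le> Suc (\<kappa> i)" "\<mu> (Suc i) \<le> \<kappa> i" for i
        using D_le[OF \<nu>, of "Suc i"] A[OF \<nu>, of i] A[OF \<nu>, of "Suc i"] tS[of i]
          partition_mono[OF part(2), of i "Suc i"]
        unfolding \<kappa> by auto
      have "is_partition \<kappa>"
      proof (rule is_partitionI)
        show "\<kappa> (Suc i) \<le> \<kappa> i" for i using lower[of i] upper[of "Suc i"] by simp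
        show "\<kappa> i = 0" if "i \<ge> n" for i using upper[of i] n[OF that] by simp
      qed
      then have "\<kappa> \<in> B"
        using lower upper part by (auto simp: B_def lower_corners_def interlaces_def interlaces'_iff)
      moreover have "snd (inverse \<nu>) \<in> {0, 1}"
        using D_le[OF \<nu>, of 0] by (auto simp: inverse_def)
      ultimately show "inverse \<nu> \<in> B \<times> {0, 1}" by (simp add: \<kappa>_def mem_Times_iff)
    qed
    show "\<forall>\<nu>\<in>A. (case inverse \<nu> of (\<kappa>, g) \<Rightarrow> growHV lam \<mu> \<kappa> g) = \<nu>"
    proof
      fix \<nu> assume \<nu>: "\<nu> \<in> A"
      obtain \<kappa> g where inv: "inverse \<nu> = (\<kappa>, g)" by (cases "inverse \<nu>")
      have \<kappa>: "\<kappa> i = min (lam i) (\<mu> i) -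
          (if ?s i \<and> ?t (Suc i) then next_carry lam \<mu> \<nu> (Suc i) else 0)" for i
        using inv by (auto simp: inverse_def)
      have g: "g = next_carry lam \<mu> \<nu> 0" using inv by (simp add: inverse_def)
      have CD: "?C \<kappa> g i = next_carry lam \<mu> \<nu> i" for i
      proof (induction i)
        case 0 then show ?case by (simp add: C_0 g)
      next
        case (Suc i)
        show ?case
        proof (cases "?t (Suc i)")
          case True
          then have "?s i \<Longrightarrow> 1 \<le> min (lam i) (\<mu> i)" using tS[of i] by simp
          then show ?thesis
            using True Suc D_le[OF \<nu>, of "Suc i"] ts[of i] next_carry_eq[OF part(2), of lam \<nu> i]
            by (auto simp: C_Suc \<kappa>)
        qed (simp add: C_Suc next_carry_def)
      qed
      have "growHV lam \<mu> \<kappa> g i = \<nu> i" for i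
      proof (cases "?s i")
        case True
        have "\<nu> i \<le> \<mu> i" if "\<not> ?t i"
          using that A[OF \<nu>, of "i - 1"] by (cases i) (auto simp: slot_def)
        then show ?thesis using A[OF \<nu>, of i] True
          by (auto simp: growHV_def CD next_carry_eq[OF part(2), of lam \<nu> i])
      next
        case False
        then show ?thesis using A[OF \<nu>, of i] by (simp add: growHV_def)
      qed
      then show "(case inverse \<nu> of (\<kappa>, g) \<Rightarrow> growHV lam \<mu> \<kappa> g) = \<nu>"
        by (simp add: inv fun_eq_iff)
    qed
  qed
  then show "bij_betw (\<lambda>(\<kappa>, g). growHV lam \<mu> \<kappa> g)
      (lower_corners (\<succ>\<^sub>h) (\<succ>\<^sub>v) lam \<mu> \<times> {0, 1}) (upper_corners (\<succ>\<^sub>h) (\<succ>\<^sub>v) lam \<mu>)"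
    by (simp add: A_def B_def)
  fix \<kappa> and g :: nat assume "\<kappa> \<in> lower_corners (\<succ>\<^sub>h) (\<succ>\<^sub>v) lam \<mu>"
  then have \<kappa>: "\<kappa> \<in> B" by (simp add: B_def)
  let ?\<nu> = "growHV lam \<mu> \<kappa> g"
  \<comment> \<open>In row \<open>i\<close> the bit that comes in and the bit of \<open>\<kappa> i\<close> equal the bit of \<open>\<nu> i\<close> and the bit that goes out.\<close>
  have local: "?\<nu> i + \<kappa> i + ?C \<kappa> g (Suc i) = lam i + \<mu> i + ?C \<kappa> g i" for i
    using B[OF \<kappa>, of i] nonfree[OF \<kappa>, of i] slot_Suc[OF part(2), of lam i]
    by (auto simp: C_Suc growHV_def)
  have sums: "sum ?\<nu> {..<k} + sum \<kappa> {..<k} + ?C \<kappa> g k = sum lam {..<k} + sum \<mu> {..<k} + g" for k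
  proof (induction k)
    case 0 then show ?case by (simp add: C_0)
  next
    case (Suc k)
    then show ?case using local[of k] by simp
  qed
  have "?C \<kappa> g i = 0" if "i \<ge> n" for i using n[OF that] by (simp add: live_carry_def slot_def)
  moreover from this have "?\<nu> i = 0" if "i \<ge> n" for i using n[OF that] that by (simp add: growHV_def)
  moreover have "\<kappa> i = 0" if "i \<ge> n" for i using B[OF \<kappa>, of i] n[OF that] by simp
  ultimately show "weight ?\<nu> + weight \<kappa> = weight lam + weight \<mu> + g"
    using sums[of n] weight_eq_sum[of n ?\<nu>] weight_eq_sum[of n \<kappa>]
      weight_eq_sum[of n lam] weight_eq_sum[of n \<mu>] n by simp
qed

lemma growth_rule_swap:
  assumes "growth_rule L R G U" shows "growth_rule R L G (\<lambda>lam \<mu>. U \<mu> lam)"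
proof -
  have "lower_corners R L lam \<mu> = lower_corners L R \<mu> lam" "upper_corners R L lam \<mu> = upper_corners L R \<mu> lam" for lam \<mu>
    by (auto simp: lower_corners_def upper_corners_def)
  then show ?thesis using assms unfolding growth_rule_def by (simp add: add.commute)
qed

subsection \<open>Sizes of corners and the inverse of a growth rule\<close>

lemma growth_rule_inverse:
  assumes "growth_rule L R G U" "is_partition lam" "is_partition \<mu>" "\<nu> \<in> upper_corners L R lam \<mu>"
  obtains \<kappa> g where "\<kappa> \<in> lower_corners L R lam \<mu>" "g \<in> G" "U lam \<mu> \<kappa> g = \<nu>"
    "weight \<nu> + weight \<kappa> = weight lam + weight \<mu> + g"
    "\<And>\<kappa>' g'. \<kappa>' \<in> lower_corners L R lam \<mu> \<Longrightarrow> g' \<in> G \<Longrightarrow> U lam \<mu> \<kappa>' g' = \<nu> \<Longrightarrow> \<kappa>' = \<kappa> \<and> g' = g"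
proof -
  have bij: "bij_betw (\<lambda>(\<kappa>, g). U lam \<mu> \<kappa> g) (lower_corners L R lam \<mu> \<times> G) (upper_corners L R lam \<mu>)"
    and wt: "\<And>\<kappa> g. \<kappa> \<in> lower_corners L R lam \<mu> \<Longrightarrow> g \<in> G \<Longrightarrow>
        weight (U lam \<mu> \<kappa> g) + weight \<kappa> = weight lam + weight \<mu> + g"
    using assms(1-3) unfolding growth_rule_def by blast+
  have "\<nu> \<in> (\<lambda>(\<kappa>, g). U lam \<mu> \<kappa> g) ` (lower_corners L R lam \<mu> \<times> G)"
    using bij assms(4) by (simp add: bij_betw_def)
  then obtain \<kappa> g where \<kappa>: "\<kappa> \<in> lower_corners L R lam \<mu>" "g \<in> G" "U lam \<mu> \<kappa> g = \<nu>"
    by auto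
  have "\<kappa>' = \<kappa> \<and> g' = g" if "\<kappa>' \<in> lower_corners L R lam \<mu>" "g' \<in> G" "U lam \<mu> \<kappa>' g' = \<nu>" for \<kappa>' g'
    using inj_onD[OF bij_betw_imp_inj_on[OF bij], of "(\<kappa>', g')" "(\<kappa>, g)"] that \<kappa> by simp
  then show ?thesis using that \<kappa> wt by blast
qed

lemma interlaces_le: "lam \<succ>\<^sub>h \<mu> \<Longrightarrow> \<mu> i \<le> lam i"
  by (simp add: interlaces_def)

lemma interlaces'_le: "is_partition lam \<Longrightarrow> is_partition \<mu> \<Longrightarrow> lam \<succ>\<^sub>v \<mu> \<Longrightarrow> \<mu> i \<le> lam i"
  by (simp add: interlaces'_iff)

lemma weight_mono:
  assumes "is_partition lam" "\<And>i. \<mu> i \<le> lam i" shows "weight \<mu> \<le> weight lam"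
proof -
  obtain n where n: "\<And>i. i \<ge> n \<Longrightarrow> lam i = 0" using partition_bound[OF assms(1)] by blast
  then have "\<And>i. i \<ge> n \<Longrightarrow> \<mu> i = 0" using assms(2) by (metis le_zero_eq)
  then show ?thesis
    using weight_eq_sum[of n lam] weight_eq_sum[of n \<mu>] n assms(2) by (simp add: sum_mono)
qed

subsection \<open>Probability mass functions\<close>

lemma pmf_Bernoulli:
  assumes "0 \<le> p" "p \<le> 1"
  shows "pmf (Bernoulli p) 0 = 1 - p" "pmf (Bernoulli p) 1 = p"
proof -
  have "pmf (Bernoulli p) (of_bool x) = pmf (bernoulli_pmf p) x" for x
    by (rule pmf_map_inj') (auto simp: inj_def)
  from this[of False] this[of True] show "pmf (Bernoulli p) 0 = 1 - p" "pmf (Bernoulli p) 1 = p"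
    using assms by simp_all
qed

lemma pmf_bind_single:
  assumes "\<And>x'. x' \<in> set_pmf p \<Longrightarrow> y \<in> set_pmf (f x') \<Longrightarrow> x' = x"
  shows "pmf (bind_pmf p f) y = pmf p x * pmf (f x) y"
proof -
  have "pmf (bind_pmf p f) y = (\<integral>x'. pmf (f x') y \<partial>measure_pmf p)" by (rule pmf_bind)
  also have "\<dots> = (\<integral>x'. indicator {x} x' * pmf (f x) y \<partial>measure_pmf p)"
    by (rule integral_cong_AE) (auto simp: AE_measure_pmf_iff indicator_def dest: assms simp: set_pmf_iff)
  also have "\<dots> = pmf p x * pmf (f x) y" by (simp add: pmf.rep_eq)
  finally show ?thesis .
qed

section \<open>The enumeration of the cells\<close>

text \<open>The inverse of \<open>cell_index\<close>, which is the Cantor pairing function with its arguments exchanged.\<close>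
definition cell :: "nat \<Rightarrow> nat \<times> nat" where
  "cell k = prod.swap (prod_decode k)"

lemma cell_index_eq: "cell_index c = prod_encode (prod.swap c)"
  by (cases c) (simp add: cell_index_def prod_encode_def triangle_def add.commute mult.commute)

lemma cell_index_cell [simp]: "cell_index (cell k) = k"
  by (simp add: cell_index_eq cell_def)

lemma cell_cell_index [simp]: "cell (cell_index c) = c"
  by (simp add: cell_index_eq cell_def)

lemma inv_cell_index: "inv cell_index = cell"
  by (rule inv_equality) simp_all

lemma cell_eq_iff: "cell k = c \<longleftrightarrow> k = cell_index c"
  by (metis cell_index_cell cell_cell_index)

lemma triangle_mono: "m \<le> n \<Longrightarrow> triangle m \<le> triangle n"
  by (induction rule: dec_induct) (auto simp: triangle_Suc intro: order_trans)

lemma cell_index_triangle: "cell_index (i, j) = triangle (i + j) + j"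
  by (simp add: cell_index_def triangle_def mult.commute)

lemma cell_index_less:
  assumes "i + j < i' + j'" shows "cell_index (i, j) < cell_index (i', j')"
proof -
  have "cell_index (i, j) < triangle (Suc (i + j))"
    by (simp add: cell_index_triangle triangle_Suc)
  also have "\<dots> \<le> triangle (i' + j')" using assms by (intro triangle_mono) simp
  also have "\<dots> \<le> cell_index (i', j')" by (simp add: cell_index_triangle)
  finally show ?thesis .
qed

lemma cell_index_strict:
  "i < i' \<Longrightarrow> cell_index (i, j) < cell_index (i', j)"
  "j < j' \<Longrightarrow> cell_index (i, j) < cell_index (i, j')"
  by (auto intro: cell_index_less)

lemma le_triangle: "n \<le> triangle n"
  by (induction n) (auto simp: triangle_Suc)

lemma cell_le: assumes "cell k = (i, j)" shows "i \<le> k" "j \<le> k"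
proof -
  have "k = triangle (i + j) + j" using assms by (simp add: cell_eq_iff cell_index_triangle)
  then show "i \<le> k" "j \<le> k" using le_triangle[of "i + j"] by auto
qed

text \<open>Row and column lengths of the Young diagram formed by the first \<open>k\<close> cells.\<close>
definition row_len :: "nat \<Rightarrow> nat \<Rightarrow> nat" where
  "row_len k i = card {j. cell_index (i, j) < k}"

definition col_len :: "nat \<Rightarrow> nat \<Rightarrow> nat" where
  "col_len k j = card {i. cell_index (i, j) < k}"

lemma less_row_len_iff: "j < row_len k i \<longleftrightarrow> cell_index (i, j) < k"
proof -
  have "{j. cell_index (i, j) < k} \<subseteq> {..<k}"
    by (auto simp: cell_index_triangle)
  then have "finite {j. cell_index (i, j) < k}" by (rule finite_subset) simp
  then have "{j. cell_index (i, j) < k} = {..<row_len k i}"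
    unfolding row_len_def
    by (rule down_closed_nat_eq) (metis cell_index_strict(2) le_neq_implies_less less_trans mem_Collect_eq)
  from arg_cong[OF this, of "\<lambda>A. j \<in> A"] show ?thesis by simp
qed

lemma less_col_len_iff: "i < col_len k j \<longleftrightarrow> cell_index (i, j) < k"
proof -
  have "i \<le> cell_index (i, j)" for i using le_triangle[of "i + j"] by (simp add: cell_index_triangle)
  then have "{i. cell_index (i, j) < k} \<subseteq> {..<k}" by (auto intro: le_less_trans)
  then have "finite {i. cell_index (i, j) < k}" by (rule finite_subset) simp
  then have "{i. cell_index (i, j) < k} = {..<col_len k j}"
    unfolding col_len_def
    by (rule down_closed_nat_eq) (metis cell_index_strict(1) le_neq_implies_less less_trans mem_Collect_eq)
  from arg_cong[OF this, of "\<lambda>A. i \<in> A"] show ?thesis by simp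
qed

lemma nat_eqI: "(\<And>j. j < m \<longleftrightarrow> j < n) \<Longrightarrow> m = (n::nat)"
  by (meson less_irrefl nat_neq_iff)

lemma row_len_0 [simp]: "row_len 0 i = 0" and col_len_0 [simp]: "col_len 0 j = 0"
  by (simp_all add: row_len_def col_len_def)

context
  fixes k i j assumes cell: "cell k = (i, j)"
begin

lemma cell_index_k: "cell_index (i, j) = k"
  using cell by (metis cell_index_cell)

lemma row_len_cell: "row_len k i = j" and row_len_Suc_cell: "row_len (Suc k) i = Suc j"
proof -
  show "row_len k i = j"
    by (rule nat_eqI) (metis cell_index_k cell_index_strict(2) less_irrefl less_row_len_iff
        nat_neq_iff less_asym)
  show "row_len (Suc k) i = Suc j"
    by (rule nat_eqI) (metis cell_index_k cell_index_strict(2) less_Suc_eq less_row_len_iff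
        nat_neq_iff less_asym)
qed

lemma col_len_cell: "col_len k j = i" and col_len_Suc_cell: "col_len (Suc k) j = Suc i"
proof -
  show "col_len k j = i"
    by (rule nat_eqI) (metis cell_index_k cell_index_strict(1) less_irrefl less_col_len_iff
        nat_neq_iff less_asym)
  show "col_len (Suc k) j = Suc i"
    by (rule nat_eqI) (metis cell_index_k cell_index_strict(1) less_Suc_eq less_col_len_iff
        nat_neq_iff less_asym)
qed

lemma row_len_Suc_other: assumes "i' \<noteq> i" shows "row_len (Suc k) i' = row_len k i'"
proof (rule nat_eqI)
  fix j' show "j' < row_len (Suc k) i' \<longleftrightarrow> j' < row_len k i'"
    using assms cell by (metis Pair_inject cell_cell_index less_Suc_eq less_row_len_iff)
qed

lemma col_len_Suc_other: assumes "j' \<noteq> j" shows "col_len (Suc k) j' = col_len k j'"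
proof (rule nat_eqI)
  fix i' show "i' < col_len (Suc k) j' \<longleftrightarrow> i' < col_len k j'"
    using assms cell by (metis Pair_inject cell_cell_index less_Suc_eq less_col_len_iff)
qed

text \<open>The boundary path visits the diagonal of the corner cell only at the corner, so every other row step
avoids it.\<close>
lemma row_edge_away:
  assumes "i' \<noteq> i"
  shows "int (row_len k i') - int i' \<noteq> int j - int i" "int (row_len k i') - int i' - 1 \<noteq> int j - int i"
proof -
  consider "i' < i" | "i' > i" using assms by linarith
  then have "int (row_len k i') - int i' < int j - int i \<or> int (row_len k i') - int i' > int j - int i + 1"
  proof cases
    case 1
    then have "j < row_len k i'" using cell_index_strict(1)[OF 1, of j] cell_index_k
      by (simp add: less_row_len_iff)
    then show ?thesis using 1 by simp
  next
    case 2
    then have "\<not> j < row_len k i'" using cell_index_strict(1)[OF 2, of j] cell_index_k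
      by (simp add: less_row_len_iff)
    then show ?thesis using 2 by simp
  qed
  then show "int (row_len k i') - int i' \<noteq> int j - int i"
    "int (row_len k i') - int i' - 1 \<noteq> int j - int i" by auto
qed

lemma col_edge_away:
  assumes "j' \<noteq> j"
  shows "int j' - int (col_len k j') \<noteq> int j - int i" "int j' - int (col_len k j') + 1 \<noteq> int j - int i"
proof -
  consider "j' < j" | "j' > j" using assms by linarith
  then have "int j' - int (col_len k j') < int j - int i - 1 \<or> int j' - int (col_len k j') > int j - int i"
  proof cases
    case 1
    then have "i < col_len k j'" using cell_index_strict(2)[OF 1, of i] cell_index_k
      by (simp add: less_col_len_iff)
    then show ?thesis using 1 by simp
  next
    case 2
    then have "\<not> i < col_len k j'" using cell_index_strict(2)[OF 2, of i] cell_index_k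
      by (simp add: less_col_len_iff)
    then show ?thesis using 2 by simp
  qed
  then show "int j' - int (col_len k j') \<noteq> int j - int i"
    "int j' - int (col_len k j') + 1 \<noteq> int j - int i" by auto
qed

end

section \<open>The Markov chain on boundary sequences\<close>

type_synonym partition_seq = "int \<Rightarrow> parts"

text \<open>A sequence of partitions along a boundary path is indexed by the diagonals \<open>j - i\<close> of the cells. Sampling
the cell \<open>(i, j)\<close> replaces \<open>(i + 1, j + 1)\<close> by \<open>(i, j)\<close>, which is on the same diagonal, so only one entry of the
sequence changes.\<close>
definition seq_step ::
    "(int \<Rightarrow> letter) \<Rightarrow> (nat \<Rightarrow> real) \<Rightarrow> (nat \<Rightarrow> real) \<Rightarrow> nat \<times> nat \<Rightarrow> partition_seq \<Rightarrow> partition_seq pmf" where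
  "seq_step w a b = (\<lambda>(i, j) \<Lambda>. let d = int j - int i in
     map_pmf (\<lambda>\<nu>. \<Lambda>(d := \<nu>))
       (sample (type_of_cell w i j) (\<Lambda> (d - 1)) (\<Lambda> (d + 1)) (\<Lambda> d) (a i * b j)))"

primrec seq_chain ::
    "(int \<Rightarrow> letter) \<Rightarrow> (nat \<Rightarrow> real) \<Rightarrow> (nat \<Rightarrow> real) \<Rightarrow> (nat \<times> nat) list \<Rightarrow> partition_seq \<Rightarrow> partition_seq pmf" where
  "seq_chain w a b [] \<Lambda> = return_pmf \<Lambda>"
| "seq_chain w a b (c # cs) \<Lambda> = bind_pmf (seq_step w a b c \<Lambda>) (seq_chain w a b cs)"

definition cells_below :: "nat \<Rightarrow> (nat \<times> nat) list" where
  "cells_below k = map cell (rev [0..<k])"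

lemma cells_below_Suc: "cells_below (Suc k) = cell k # cells_below k"
  by (simp add: cells_below_def)

text \<open>On the boundary path of the first \<open>k\<close> cells, the step from row \<open>i + 1\<close> to row \<open>i\<close> ends on diagonal
\<open>row_edge k i\<close>, and the step from column \<open>j\<close> to column \<open>j + 1\<close> starts on diagonal \<open>col_edge k j\<close>.\<close>
definition row_edge :: "nat \<Rightarrow> nat \<Rightarrow> int" where
  "row_edge k i = int (row_len k i) - int i"
definition col_edge :: "nat \<Rightarrow> nat \<Rightarrow> int" where
  "col_edge k j = int j - int (col_len k j)"

definition compatible :: "(int \<Rightarrow> letter) \<Rightarrow> nat \<Rightarrow> partition_seq \<Rightarrow> bool" where
  "compatible w k \<Lambda> \<longleftrightarrow> (\<forall>d. is_partition (\<Lambda> d)) \<and> finite {d. \<Lambda> d \<noteq> empty_part} \<and>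
     (\<forall>i. related (w (- int i)) (\<Lambda> (row_edge k i - 1)) (\<Lambda> (row_edge k i))) \<and>
     (\<forall>j. related (w (int j + 1)) (\<Lambda> (col_edge k j)) (\<Lambda> (col_edge k j + 1)))"

text \<open>The Schur weight along the boundary path, with the products cut off at \<open>n\<close>. The truncated subtractions are
harmless on compatible sequences, where the step relations order the sizes.\<close>
definition path_weight :: "(nat \<Rightarrow> real) \<Rightarrow> (nat \<Rightarrow> real) \<Rightarrow> nat \<Rightarrow> nat \<Rightarrow> partition_seq \<Rightarrow> real" where
  "path_weight a b n k \<Lambda> =
     (\<Prod>i<n. a i ^ (weight (\<Lambda> (row_edge k i)) - weight (\<Lambda> (row_edge k i - 1)))) *
     (\<Prod>j<n. b j ^ (weight (\<Lambda> (col_edge k j)) - weight (\<Lambda> (col_edge k j + 1))))"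

text \<open>The array vanishes along the boundary path at all vertices in rows or columns beyond \<open>m\<close>. For large \<open>k\<close>
every vertex is of this kind, and for \<open>k = 0\<close> the condition says that the support lies in \<open>-m, ..., m\<close>.\<close>
definition confined :: "nat \<Rightarrow> nat \<Rightarrow> partition_seq \<Rightarrow> bool" where
  "confined m k \<Lambda> \<longleftrightarrow> (\<forall>d. d < row_edge k m \<or> d > col_edge k m \<longrightarrow> \<Lambda> d = empty_part)"

lemma finite_off_iff: "finite {d. d \<noteq> d0 \<and> P d} \<longleftrightarrow> finite {d. P d}"
proof -
  have "{d. P d} \<subseteq> insert d0 {d. d \<noteq> d0 \<and> P d}" by auto
  moreover have "{d. d \<noteq> d0 \<and> P d} \<subseteq> {d. P d}" by auto
  ultimately show ?thesis using finite_subset finite_insert by metis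
qed

locale pyramid =
  fixes w :: "int \<Rightarrow> letter" and a b :: "nat \<Rightarrow> real"
  assumes w_le_0: "\<And>k. k \<le> 0 \<Longrightarrow> w k \<in> {Prec, Prec'}"
    and w_ge_1: "\<And>k. k \<ge> 1 \<Longrightarrow> w k \<in> {Succ, Succ'}"
    and a_nonneg: "\<And>i. a i \<ge> 0" and b_nonneg: "\<And>i. b i \<ge> 0"
    and summable_ab: "summable (\<lambda>i. a i + b i)"
    and ab_less_1: "\<And>i j. (w (- int i), w (int j + 1)) \<in> {(Prec, Succ), (Prec', Succ')} \<Longrightarrow> a i * b j < 1"
begin

definition row_rel :: "nat \<Rightarrow> parts \<Rightarrow> parts \<Rightarrow> bool" where
  "row_rel i \<nu> lam = related (w (- int i)) lam \<nu>"
definition col_rel :: "nat \<Rightarrow> parts \<Rightarrow> parts \<Rightarrow> bool" where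
  "col_rel j \<nu> \<mu> = related (w (int j + 1)) \<nu> \<mu>"

lemma row_rel_cases:
  obtains "w (- int i) = Prec" "row_rel i = (\<succ>\<^sub>h)" | "w (- int i) = Prec'" "row_rel i = (\<succ>\<^sub>v)"
  using w_le_0[of "- int i"] by (auto simp: row_rel_def fun_eq_iff)

lemma col_rel_cases:
  obtains "w (int j + 1) = Succ" "col_rel j = (\<succ>\<^sub>h)" | "w (int j + 1) = Succ'" "col_rel j = (\<succ>\<^sub>v)"
  using w_ge_1[of "int j + 1"] by (auto simp: col_rel_def fun_eq_iff)

lemma row_rel_le: "is_partition \<nu> \<Longrightarrow> is_partition lam \<Longrightarrow> row_rel i \<nu> lam \<Longrightarrow> lam l \<le> \<nu> l"
  by (cases rule: row_rel_cases[of i]) (auto intro: interlaces_le interlaces'_le)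

lemma col_rel_le: "is_partition \<nu> \<Longrightarrow> is_partition \<mu> \<Longrightarrow> col_rel j \<nu> \<mu> \<Longrightarrow> \<mu> l \<le> \<nu> l"
  by (cases rule: col_rel_cases[of j]) (auto intro: interlaces_le interlaces'_le)

lemma related_empty: "row_rel i empty_part empty_part" "col_rel j empty_part empty_part"
  by (cases rule: row_rel_cases[of i]; cases rule: col_rel_cases[of j];
      simp add: interlaces'_iff[OF is_partition_empty is_partition_empty] interlaces_def;
      simp add: empty_part_def)+

lemma ab_nonneg: "0 \<le> a i * b j" by (simp add: a_nonneg b_nonneg)

text \<open>The four cell types in one form. The draw \<open>N\<close> is geometric or Bernoulli, and in both cases \<open>1 - c\<close> is the
normalizing constant of the weights \<open>(a i * b j) ^ g\<close>.\<close>
lemma sample_growth: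
  obtains G U N where "growth_rule (row_rel i) (col_rel j) G U" "set_pmf N \<subseteq> G"
    "\<And>g. g \<in> G \<Longrightarrow> pmf N g = (1 - cell_const w a b (i, j)) * (a i * b j) ^ g"
    "\<And>lam \<mu> \<kappa>. is_partition lam \<Longrightarrow> is_partition \<mu> \<Longrightarrow>
       sample (type_of_cell w i j) lam \<mu> \<kappa> (a i * b j) = map_pmf (U lam \<mu> \<kappa>) N"
proof -
  let ?\<xi> = "a i * b j"
  have geom: "pmf (Geom ?\<xi>) g = (1 - ?\<xi>) * ?\<xi> ^ g" if "?\<xi> < 1" for g
    using that ab_nonneg[of i j] by (simp add: geometric_pmf.rep_eq)
  define p where "p = ?\<xi> / (1 + ?\<xi>)"
  have p: "0 \<le> p" "p \<le> 1" "1 - p = 1 / (1 + ?\<xi>)" "p = (1 - p) * ?\<xi>"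
    using ab_nonneg[of i j] by (auto simp: p_def field_simps)
  have bern: "pmf (Bernoulli p) g = (1 - p) * ?\<xi> ^ g" if "g \<in> {0, 1}" for g
    using that pmf_Bernoulli[OF p(1,2)] p(4) by auto
  have bern_set: "set_pmf (Bernoulli p) \<subseteq> {0, 1}" by auto
  consider (HH) "w (- int i) = Prec" "row_rel i = (\<succ>\<^sub>h)" "w (int j + 1) = Succ" "col_rel j = (\<succ>\<^sub>h)"
    | (HV) "w (- int i) = Prec" "row_rel i = (\<succ>\<^sub>h)" "w (int j + 1) = Succ'" "col_rel j = (\<succ>\<^sub>v)"
    | (VH) "w (- int i) = Prec'" "row_rel i = (\<succ>\<^sub>v)" "w (int j + 1) = Succ" "col_rel j = (\<succ>\<^sub>h)"
    | (VV) "w (- int i) = Prec'" "row_rel i = (\<succ>\<^sub>v)" "w (int j + 1) = Succ'" "col_rel j = (\<succ>\<^sub>v)"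
    by (cases rule: row_rel_cases[of i]; cases rule: col_rel_cases[of j]) auto
  then show ?thesis
  proof cases
    case HH
    then have T: "type_of_cell w i j = cell_type.HH" by (simp add: type_of_cell_def)
    show ?thesis
      by (rule that[of UNIV growHH "Geom ?\<xi>"])
        (use HH T growth_rule_HH geom ab_less_1[of i j] in \<open>simp_all add: sampleHH_eq cell_const_def\<close>)
  next
    case VV
    then have T: "type_of_cell w i j = cell_type.VV" by (simp add: type_of_cell_def)
    show ?thesis
      by (rule that[of UNIV growVV "Geom ?\<xi>"])
        (use VV T growth_rule_VV geom ab_less_1[of i j] in \<open>simp_all add: sampleVV_eq cell_const_def\<close>)
  next
    case HV
    then have T: "type_of_cell w i j = cell_type.HV" by (simp add: type_of_cell_def)
    show ?thesis
      by (rule that[of "{0, 1}" growHV "Bernoulli p"])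
        (use HV T growth_rule_HV bern bern_set in \<open>simp_all add: sampleHV_eq cell_const_def p_def\<close>)
  next
    case VH
    then have T: "type_of_cell w i j = cell_type.VH" by (simp add: type_of_cell_def)
    show ?thesis
      by (rule that[of "{0, 1}" "\<lambda>lam \<mu>. growHV \<mu> lam" "Bernoulli p"])
        (use VH T growth_rule_swap[OF growth_rule_HV] bern bern_set in
          \<open>simp_all add: sampleVH_def sampleHV_eq cell_const_def p_def\<close>)
  qed
qed

lemma sample_support:
  assumes "is_partition lam" "is_partition \<mu>" "\<kappa> \<in> lower_corners (row_rel i) (col_rel j) lam \<mu>"
    and "\<nu> \<in> set_pmf (sample (type_of_cell w i j) lam \<mu> \<kappa> (a i * b j))"
  shows "\<nu> \<in> upper_corners (row_rel i) (col_rel j) lam \<mu>"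
proof -
  obtain G U N where U: "growth_rule (row_rel i) (col_rel j) G U" "set_pmf N \<subseteq> G"
    "\<And>lam \<mu> \<kappa>. is_partition lam \<Longrightarrow> is_partition \<mu> \<Longrightarrow>
       sample (type_of_cell w i j) lam \<mu> \<kappa> (a i * b j) = map_pmf (U lam \<mu> \<kappa>) N"
    by (rule sample_growth[of i j]) blast
  have "bij_betw (\<lambda>(\<kappa>, g). U lam \<mu> \<kappa> g) (lower_corners (row_rel i) (col_rel j) lam \<mu> \<times> G)
      (upper_corners (row_rel i) (col_rel j) lam \<mu>)"
    using U(1) assms(1,2) unfolding growth_rule_def by blast
  from bij_betwE[OF this] show ?thesis using assms U(2,3) by auto
qed

lemma sample_inverse:
  assumes "is_partition lam" "is_partition \<mu>" "\<nu> \<in> upper_corners (row_rel i) (col_rel j) lam \<mu>"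
  obtains \<kappa> g where "\<kappa> \<in> lower_corners (row_rel i) (col_rel j) lam \<mu>"
    "weight \<nu> + weight \<kappa> = weight lam + weight \<mu> + g"
    "pmf (sample (type_of_cell w i j) lam \<mu> \<kappa> (a i * b j)) \<nu> =
       (1 - cell_const w a b (i, j)) * (a i * b j) ^ g"
    "\<And>\<kappa>'. \<kappa>' \<in> lower_corners (row_rel i) (col_rel j) lam \<mu> \<Longrightarrow>
       \<nu> \<in> set_pmf (sample (type_of_cell w i j) lam \<mu> \<kappa>' (a i * b j)) \<Longrightarrow> \<kappa>' = \<kappa>"
proof -
  obtain G U N where U: "growth_rule (row_rel i) (col_rel j) G U" "set_pmf N \<subseteq> G"
    "\<And>g. g \<in> G \<Longrightarrow> pmf N g = (1 - cell_const w a b (i, j)) * (a i * b j) ^ g"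
    "\<And>lam \<mu> \<kappa>. is_partition lam \<Longrightarrow> is_partition \<mu> \<Longrightarrow>
       sample (type_of_cell w i j) lam \<mu> \<kappa> (a i * b j) = map_pmf (U lam \<mu> \<kappa>) N"
    by (rule sample_growth[of i j]) blast
  obtain \<kappa> g where \<kappa>: "\<kappa> \<in> lower_corners (row_rel i) (col_rel j) lam \<mu>" "g \<in> G" "U lam \<mu> \<kappa> g = \<nu>"
    "weight \<nu> + weight \<kappa> = weight lam + weight \<mu> + g"
    "\<And>\<kappa>' g'. \<kappa>' \<in> lower_corners (row_rel i) (col_rel j) lam \<mu> \<Longrightarrow> g' \<in> G \<Longrightarrow> U lam \<mu> \<kappa>' g' = \<nu> \<Longrightarrow> \<kappa>' = \<kappa> \<and> g' = g"
    by (rule growth_rule_inverse[OF U(1) assms]) blast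
  have "pmf (map_pmf (U lam \<mu> \<kappa>) N) \<nu> = measure_pmf.prob N (U lam \<mu> \<kappa> -` {\<nu>})"
    by (rule pmf_map)
  also have "\<dots> = measure_pmf.prob N (U lam \<mu> \<kappa> -` {\<nu>} \<inter> set_pmf N)"
    by (simp add: measure_Int_set_pmf)
  also have "\<dots> = measure_pmf.prob N ({g} \<inter> set_pmf N)"
  proof (rule arg_cong[where f = "measure_pmf.prob N"])
    have "U lam \<mu> \<kappa> x = \<nu> \<longleftrightarrow> x = g" if "x \<in> set_pmf N" for x
      using \<kappa>(3) \<kappa>(5)[OF \<kappa>(1), of x] U(2) that by blast
    then show "U lam \<mu> \<kappa> -` {\<nu>} \<inter> set_pmf N = {g} \<inter> set_pmf N" by blast
  qed
  also have "\<dots> = pmf N g" by (simp add: measure_Int_set_pmf measure_pmf_single)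
  finally have p: "pmf (sample (type_of_cell w i j) lam \<mu> \<kappa> (a i * b j)) \<nu> =
       (1 - cell_const w a b (i, j)) * (a i * b j) ^ g"
    using U(3)[OF \<kappa>(2)] U(4)[OF assms(1,2)] by simp
  show ?thesis
  proof (rule that[OF \<kappa>(1,4) p])
    fix \<kappa>' assume "\<kappa>' \<in> lower_corners (row_rel i) (col_rel j) lam \<mu>"
      "\<nu> \<in> set_pmf (sample (type_of_cell w i j) lam \<mu> \<kappa>' (a i * b j))"
    then show "\<kappa>' = \<kappa>" using \<kappa>(5)[of \<kappa>'] U(2) unfolding U(4)[OF assms(1,2)] set_map_pmf by blast
  qed
qed

text \<open>Removing the corner cell \<open>(i, j)\<close> exchanges a column step followed by a row step with a row step followed by a
column step, both meeting on the diagonal \<open>j - i\<close>, and leaves all other steps in place.\<close>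
lemma cell_edges:
  assumes "cell k = (i, j)"
  shows "row_edge k i = int j - int i" "row_edge (Suc k) i = int j - int i + 1"
    "col_edge k j = int j - int i" "col_edge (Suc k) j = int j - int i - 1"
    "i' \<noteq> i \<Longrightarrow> row_edge (Suc k) i' = row_edge k i'"
    "i' \<noteq> i \<Longrightarrow> row_edge k i' \<noteq> int j - int i" "i' \<noteq> i \<Longrightarrow> row_edge k i' - 1 \<noteq> int j - int i"
    "j' \<noteq> j \<Longrightarrow> col_edge (Suc k) j' = col_edge k j'"
    "j' \<noteq> j \<Longrightarrow> col_edge k j' \<noteq> int j - int i" "j' \<noteq> j \<Longrightarrow> col_edge k j' + 1 \<noteq> int j - int i"
  using row_edge_away[OF assms, of i'] col_edge_away[OF assms, of j']
  by (auto simp: row_edge_def col_edge_def row_len_cell[OF assms] row_len_Suc_cell[OF assms]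
      col_len_cell[OF assms] col_len_Suc_cell[OF assms] row_len_Suc_other[OF assms]
      col_len_Suc_other[OF assms])

text \<open>The part of compatibility that does not see the entry on the diagonal of cell \<open>k\<close>. It is common to the
diagrams with \<open>k\<close> and with \<open>k + 1\<close> cells.\<close>
definition compatible_off :: "nat \<Rightarrow> partition_seq \<Rightarrow> bool" where
  "compatible_off k \<Lambda> = (case cell k of (i, j) \<Rightarrow> let d0 = int j - int i in
     (\<forall>d. d \<noteq> d0 \<longrightarrow> is_partition (\<Lambda> d)) \<and> finite {d. d \<noteq> d0 \<and> \<Lambda> d \<noteq> empty_part} \<and>
     (\<forall>i'. i' \<noteq> i \<longrightarrow> row_rel i' (\<Lambda> (row_edge k i')) (\<Lambda> (row_edge k i' - 1))) \<and>
     (\<forall>j'. j' \<noteq> j \<longrightarrow> col_rel j' (\<Lambda> (col_edge k j')) (\<Lambda> (col_edge k j' + 1))))"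

lemma compatible_split:
  assumes "cell k = (i, j)" and d: "d = int j - int i"
  shows "compatible w k \<Lambda> \<longleftrightarrow>
      compatible_off k \<Lambda> \<and> \<Lambda> d \<in> upper_corners (row_rel i) (col_rel j) (\<Lambda> (d - 1)) (\<Lambda> (d + 1))"
    and "compatible w (Suc k) \<Lambda> \<longleftrightarrow>
      compatible_off k \<Lambda> \<and> \<Lambda> d \<in> lower_corners (row_rel i) (col_rel j) (\<Lambda> (d - 1)) (\<Lambda> (d + 1))"
proof -
  note e = cell_edges[OF assms(1), folded d]
  have comp: "compatible w k \<Lambda> \<longleftrightarrow> (\<forall>d. is_partition (\<Lambda> d)) \<and> finite {d. \<Lambda> d \<noteq> empty_part} \<and>
     (\<forall>i. row_rel i (\<Lambda> (row_edge k i)) (\<Lambda> (row_edge k i - 1))) \<and>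
     (\<forall>j. col_rel j (\<Lambda> (col_edge k j)) (\<Lambda> (col_edge k j + 1)))" for k
    by (simp add: compatible_def row_rel_def col_rel_def)
  have off: "compatible_off k \<Lambda> \<longleftrightarrow> (\<forall>x. x \<noteq> d \<longrightarrow> is_partition (\<Lambda> x)) \<and> finite {d. \<Lambda> d \<noteq> empty_part} \<and>
     (\<forall>x. x \<noteq> i \<longrightarrow> row_rel x (\<Lambda> (row_edge k x)) (\<Lambda> (row_edge k x - 1))) \<and>
     (\<forall>x. x \<noteq> j \<longrightarrow> col_rel x (\<Lambda> (col_edge k x)) (\<Lambda> (col_edge k x + 1)))"
    by (simp add: compatible_off_def assms(1) d finite_off_iff)
  have p: "(\<forall>x. is_partition (\<Lambda> x)) \<longleftrightarrow> (\<forall>x. x \<noteq> d \<longrightarrow> is_partition (\<Lambda> x)) \<and> is_partition (\<Lambda> d)"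
    by metis
  have r: "(\<forall>x. row_rel x (\<Lambda> (row_edge k' x)) (\<Lambda> (row_edge k' x - 1))) \<longleftrightarrow>
      (\<forall>x. x \<noteq> i \<longrightarrow> row_rel x (\<Lambda> (row_edge k x)) (\<Lambda> (row_edge k x - 1))) \<and>
      row_rel i (\<Lambda> (row_edge k' i)) (\<Lambda> (row_edge k' i - 1))" if "k' \<in> {k, Suc k}" for k'
    using that e(5) by (metis empty_iff insert_iff)
  have c: "(\<forall>x. col_rel x (\<Lambda> (col_edge k' x)) (\<Lambda> (col_edge k' x + 1))) \<longleftrightarrow>
      (\<forall>x. x \<noteq> j \<longrightarrow> col_rel x (\<Lambda> (col_edge k x)) (\<Lambda> (col_edge k x + 1))) \<and>
      col_rel j (\<Lambda> (col_edge k' j)) (\<Lambda> (col_edge k' j + 1))" if "k' \<in> {k, Suc k}" for k'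
    using that e(8) by (metis empty_iff insert_iff)
  have k: "k \<in> {k, Suc k}" "Suc k \<in> {k, Suc k}" by simp_all
  show "compatible w k \<Lambda> \<longleftrightarrow>
      compatible_off k \<Lambda> \<and> \<Lambda> d \<in> upper_corners (row_rel i) (col_rel j) (\<Lambda> (d - 1)) (\<Lambda> (d + 1))"
    unfolding comp off p r[OF k(1)] c[OF k(1)] e(1,3) upper_corners_def by blast
  show "compatible w (Suc k) \<Lambda> \<longleftrightarrow>
      compatible_off k \<Lambda> \<and> \<Lambda> d \<in> lower_corners (row_rel i) (col_rel j) (\<Lambda> (d - 1)) (\<Lambda> (d + 1))"
    unfolding comp off p r[OF k(2)] c[OF k(2)] e(2,4) lower_corners_def by auto
qed

lemma compatible_off_update:
  assumes "cell k = (i, j)"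
  shows "compatible_off k (\<Lambda>(int j - int i := x)) = compatible_off k \<Lambda>"
proof -
  note e = cell_edges[OF assms]
  have "{d. d \<noteq> int j - int i \<and> (\<Lambda>(int j - int i := x)) d \<noteq> empty_part} =
      {d. d \<noteq> int j - int i \<and> \<Lambda> d \<noteq> empty_part}" by auto
  then show ?thesis
    unfolding compatible_off_def assms case_prod_conv Let_def
    using e(6,7,9,10) by (auto cong: conj_cong)
qed

lemma compatible_empty: "compatible w k (\<lambda>_. empty_part)"
  using related_empty by (simp add: compatible_def row_rel_def col_rel_def is_partition_empty)

text \<open>Only the two steps that meet at the corner contribute to the quotient. By the size identity each of their
exponents grows by \<open>g\<close>.\<close>
lemma path_weight_step:
  assumes "cell k = (i, j)" and d: "d = int j - int i" and "i < n" "j < n"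
    and \<Lambda>: "compatible w k \<Lambda>" and \<Lambda>': "compatible w (Suc k) (\<Lambda>(d := \<kappa>))"
    and wt: "weight (\<Lambda> d) + weight \<kappa> = weight (\<Lambda> (d - 1)) + weight (\<Lambda> (d + 1)) + g"
  shows "path_weight a b n k \<Lambda> = path_weight a b n (Suc k) (\<Lambda>(d := \<kappa>)) * (a i * b j) ^ g"
proof -
  note e = cell_edges[OF assms(1), folded d]
  let ?\<Lambda>' = "\<Lambda>(d := \<kappa>)"
  have \<kappa>: "\<kappa> \<in> lower_corners (row_rel i) (col_rel j) (\<Lambda> (d - 1)) (\<Lambda> (d + 1))"
    using \<Lambda>' compatible_split(2)[OF assms(1) d] by auto
  have part: "is_partition (\<Lambda> x)" for x using \<Lambda> by (simp add: compatible_def)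
  have le1: "weight \<kappa> \<le> weight (\<Lambda> (d + 1))" and le2: "weight \<kappa> \<le> weight (\<Lambda> (d - 1))"
    using \<kappa> part by (auto simp: lower_corners_def intro!: weight_mono intro: row_rel_le col_rel_le)
  define PA where "PA = (\<Prod>x\<in>{..<n} - {i}. a x ^ (weight (\<Lambda> (row_edge k x)) - weight (\<Lambda> (row_edge k x - 1))))"
  define PB where "PB = (\<Prod>x\<in>{..<n} - {j}. b x ^ (weight (\<Lambda> (col_edge k x)) - weight (\<Lambda> (col_edge k x + 1))))"
  have PA': "PA = (\<Prod>x\<in>{..<n} - {i}. a x ^ (weight (?\<Lambda>' (row_edge (Suc k) x)) - weight (?\<Lambda>' (row_edge (Suc k) x - 1))))"
    unfolding PA_def by (rule prod.cong) (auto simp: e(5,6,7))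
  have PB': "PB = (\<Prod>x\<in>{..<n} - {j}. b x ^ (weight (?\<Lambda>' (col_edge (Suc k) x)) - weight (?\<Lambda>' (col_edge (Suc k) x + 1))))"
    unfolding PB_def by (rule prod.cong) (auto simp: e(8,9,10))
  have ra: "prod f {..<n} = f i * prod f ({..<n} - {i})" and rb: "prod f {..<n} = f j * prod f ({..<n} - {j})"
    for f :: "nat \<Rightarrow> real"
    using \<open>i < n\<close> \<open>j < n\<close> by (auto intro: prod.remove)
  have 1: "path_weight a b n k \<Lambda> = (a i ^ (weight (\<Lambda> d) - weight (\<Lambda> (d - 1))) * PA) *
      (b j ^ (weight (\<Lambda> d) - weight (\<Lambda> (d + 1))) * PB)"
    unfolding path_weight_def
    by (rule arg_cong2[where f = "(*)"], subst ra, simp add: e(1,3) PA_def,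
        subst rb, simp add: e(1,3) PB_def)
  have 2: "path_weight a b n (Suc k) ?\<Lambda>' = (a i ^ (weight (\<Lambda> (d + 1)) - weight \<kappa>) * PA) *
      (b j ^ (weight (\<Lambda> (d - 1)) - weight \<kappa>) * PB)"
    unfolding path_weight_def
    by (rule arg_cong2[where f = "(*)"], subst ra, simp add: e(2,4) PA',
        subst rb, simp add: e(2,4) PB')
  have "weight (\<Lambda> d) - weight (\<Lambda> (d - 1)) = (weight (\<Lambda> (d + 1)) - weight \<kappa>) + g"
    "weight (\<Lambda> d) - weight (\<Lambda> (d + 1)) = (weight (\<Lambda> (d - 1)) - weight \<kappa>) + g"
    using wt le1 le2 by linarith+
  then show ?thesis unfolding 1 2 by (simp add: power_add power_mult_distrib)
qed

text \<open>The predecessor \<open>\<kappa>\<close> lies beyond row or column \<open>m\<close> only if one of its neighbours does; that neighbour is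
empty and contains \<open>\<kappa>\<close>.\<close>
lemma confined_step:
  assumes "cell k = (i, j)" and d: "d = int j - int i"
    and "confined m k \<Lambda>" and "compatible w (Suc k) (\<Lambda>(d := \<kappa>))"
  shows "confined m (Suc k) (\<Lambda>(d := \<kappa>))"
proof -
  note e = cell_edges[OF assms(1), folded d]
  have \<kappa>: "\<kappa> \<in> lower_corners (row_rel i) (col_rel j) (\<Lambda> (d - 1)) (\<Lambda> (d + 1))"
    using assms(4) compatible_split(2)[OF assms(1) d] by auto
  have part: "is_partition (\<Lambda> (d - 1))" "is_partition (\<Lambda> (d + 1))" "is_partition \<kappa>"
    using assms(4) unfolding compatible_def by (metis fun_upd_other fun_upd_same add_cancel_left_right
        diff_add_cancel zero_neq_one)+
  have r: "row_edge (Suc k) m = row_edge k m \<or> (m = i \<and> row_edge (Suc k) m = d + 1 \<and> row_edge k m = d)"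
    using e by metis
  have c: "col_edge (Suc k) m = col_edge k m \<or> (m = j \<and> col_edge (Suc k) m = d - 1 \<and> col_edge k m = d)"
    using e by metis
  show ?thesis unfolding confined_def
  proof (intro allI impI)
    fix x assume x: "x < row_edge (Suc k) m \<or> x > col_edge (Suc k) m"
    show "(\<Lambda>(d := \<kappa>)) x = empty_part"
    proof (cases "x = d")
      case False
      then have "x < row_edge k m \<or> x > col_edge k m" using x r c by auto
      then have "\<Lambda> x = empty_part" using assms(3) unfolding confined_def by blast
      then show ?thesis using False by simp
    next
      case True
      then have "d - 1 < row_edge k m \<or> d + 1 > col_edge k m" using x r c by auto
      then have "\<Lambda> (d - 1) = empty_part \<or> \<Lambda> (d + 1) = empty_part"
        using assms(3) by (auto simp: confined_def)
      moreover have "\<kappa> l \<le> \<Lambda> (d - 1) l" "\<kappa> l \<le> \<Lambda> (d + 1) l" for l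
        using \<kappa> part row_rel_le col_rel_le by (auto simp: lower_corners_def)
      ultimately have "\<kappa> = empty_part" using empty_part_below[OF part(3)] by metis
      then show ?thesis using True by simp
    qed
  qed
qed

lemma pmf_seq_step:
  assumes "cell k = (i, j)" and d: "d = int j - int i"
  shows "seq_step w a b (cell k) \<Lambda> = map_pmf (\<lambda>\<nu>. \<Lambda>(d := \<nu>))
      (sample (type_of_cell w i j) (\<Lambda> (d - 1)) (\<Lambda> (d + 1)) (\<Lambda> d) (a i * b j))"
    and "pmf (seq_step w a b (cell k) (\<Lambda>(d := \<kappa>))) \<Lambda> =
      pmf (sample (type_of_cell w i j) (\<Lambda> (d - 1)) (\<Lambda> (d + 1)) \<kappa> (a i * b j)) (\<Lambda> d)"
proof -
  show eq: "seq_step w a b (cell k) \<Lambda> = map_pmf (\<lambda>\<nu>. \<Lambda>(d := \<nu>))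
      (sample (type_of_cell w i j) (\<Lambda> (d - 1)) (\<Lambda> (d + 1)) (\<Lambda> d) (a i * b j))" for \<Lambda>
    using assms by (simp add: seq_step_def Let_def)
  have inj: "inj (\<lambda>\<nu>. \<Lambda>(d := \<nu>))" by (metis (mono_tags) fun_upd_same injI)
  have "pmf (map_pmf (\<lambda>\<nu>. \<Lambda>(d := \<nu>)) q) (\<Lambda>(d := \<Lambda> d)) = pmf q (\<Lambda> d)" for q
    by (rule pmf_map_inj'[OF inj])
  moreover have "fun_upd (\<Lambda>(d := \<kappa>)) d = fun_upd \<Lambda> d" by auto
  ultimately show "pmf (seq_step w a b (cell k) (\<Lambda>(d := \<kappa>))) \<Lambda> =
      pmf (sample (type_of_cell w i j) (\<Lambda> (d - 1)) (\<Lambda> (d + 1)) \<kappa> (a i * b j)) (\<Lambda> d)"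
    unfolding eq by simp
qed

text \<open>The law is proportional to the path weight, at least on confined sequences, and never leaves the compatible
ones. The restriction to confined sequences allows a start from the empty sequence, whose law is a point
mass.\<close>
definition has_path_law :: "nat \<Rightarrow> nat \<Rightarrow> nat \<Rightarrow> real \<Rightarrow> partition_seq pmf \<Rightarrow> bool" where
  "has_path_law m n k C p \<longleftrightarrow> (\<forall>\<Lambda>\<in>set_pmf p. compatible w k \<Lambda>) \<and>
     (\<forall>\<Lambda>. compatible w k \<Lambda> \<longrightarrow> confined m k \<Lambda> \<longrightarrow> pmf p \<Lambda> = C * path_weight a b n k \<Lambda>)"

text \<open>By injectivity of the growth rule exactly one compatible sequence can be the predecessor of a given one, so
the probability of the latter is a single product.\<close>
lemma has_path_law_step:
  assumes "has_path_law m n (Suc k) C p" and "k < n"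
  shows "has_path_law m n k (C * (1 - cell_const w a b (cell k)))
    (bind_pmf p (seq_step w a b (cell k)))"
proof -
  obtain i j where ij: "cell k = (i, j)" by (cases "cell k")
  define d where "d = int j - int i"
  note split = compatible_split[OF ij d_def]
  note off = compatible_off_update[OF ij, folded d_def]
  note step = pmf_seq_step[OF ij d_def]
  have "i < n" "j < n" using cell_le[OF ij] assms(2) by auto
  have comp: "compatible w (Suc k) \<Lambda>" if "\<Lambda> \<in> set_pmf p" for \<Lambda>
    using assms(1) that by (simp add: has_path_law_def)
  have law: "pmf p \<Lambda> = C * path_weight a b n (Suc k) \<Lambda>"
    if "compatible w (Suc k) \<Lambda>" "confined m (Suc k) \<Lambda>" for \<Lambda>
    using assms(1) that by (simp add: has_path_law_def)
  show ?thesis unfolding has_path_law_def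
  proof (intro conjI ballI allI impI)
    fix \<Lambda> assume "\<Lambda> \<in> set_pmf (bind_pmf p (seq_step w a b (cell k)))"
    then obtain \<Lambda>1 \<nu> where \<Lambda>1: "\<Lambda>1 \<in> set_pmf p" and \<Lambda>: "\<Lambda> = \<Lambda>1(d := \<nu>)"
      and \<nu>: "\<nu> \<in> set_pmf (sample (type_of_cell w i j) (\<Lambda>1 (d - 1)) (\<Lambda>1 (d + 1)) (\<Lambda>1 d) (a i * b j))"
      by (auto simp: step(1))
    have c: "compatible w (Suc k) \<Lambda>1" by (rule comp[OF \<Lambda>1])
    then have "is_partition (\<Lambda>1 (d - 1))" "is_partition (\<Lambda>1 (d + 1))"
      by (simp_all add: compatible_def)
    then have "\<nu> \<in> upper_corners (row_rel i) (col_rel j) (\<Lambda>1 (d - 1)) (\<Lambda>1 (d + 1))"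
      using sample_support \<nu> c split(2) by blast
    then show "compatible w k \<Lambda>" using c split off by (simp add: \<Lambda>)
  next
    fix \<Lambda> assume \<Lambda>: "compatible w k \<Lambda>" "confined m k \<Lambda>"
    then have part: "is_partition (\<Lambda> (d - 1))" "is_partition (\<Lambda> (d + 1))"
      by (simp_all add: compatible_def)
    have "\<Lambda> d \<in> upper_corners (row_rel i) (col_rel j) (\<Lambda> (d - 1)) (\<Lambda> (d + 1))" using \<Lambda>(1) split(1) by simp
    then obtain \<kappa> g where \<kappa>: "\<kappa> \<in> lower_corners (row_rel i) (col_rel j) (\<Lambda> (d - 1)) (\<Lambda> (d + 1))"
      "weight (\<Lambda> d) + weight \<kappa> = weight (\<Lambda> (d - 1)) + weight (\<Lambda> (d + 1)) + g"
      "pmf (sample (type_of_cell w i j) (\<Lambda> (d - 1)) (\<Lambda> (d + 1)) \<kappa> (a i * b j)) (\<Lambda> d) =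
         (1 - cell_const w a b (i, j)) * (a i * b j) ^ g"
      "\<And>\<kappa>'. \<kappa>' \<in> lower_corners (row_rel i) (col_rel j) (\<Lambda> (d - 1)) (\<Lambda> (d + 1)) \<Longrightarrow>
         \<Lambda> d \<in> set_pmf (sample (type_of_cell w i j) (\<Lambda> (d - 1)) (\<Lambda> (d + 1)) \<kappa>' (a i * b j)) \<Longrightarrow> \<kappa>' = \<kappa>"
      using sample_inverse[OF part] by metis
    let ?\<Lambda>1 = "\<Lambda>(d := \<kappa>)"
    have c1: "compatible w (Suc k) ?\<Lambda>1" using \<kappa>(1) \<Lambda>(1) split off by simp
    \<comment> \<open>A predecessor agrees with \<open>\<Lambda>\<close> off the diagonal \<open>d\<close>, and there it has to be \<open>\<kappa>\<close>.\<close>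
    have uniq: "\<Lambda>' = ?\<Lambda>1"
      if \<Lambda>': "\<Lambda>' \<in> set_pmf p" "\<Lambda> \<in> set_pmf (seq_step w a b (cell k) \<Lambda>')" for \<Lambda>'
    proof -
      obtain \<nu> where \<nu>: "\<Lambda> = \<Lambda>'(d := \<nu>)"
        "\<nu> \<in> set_pmf (sample (type_of_cell w i j) (\<Lambda>' (d - 1)) (\<Lambda>' (d + 1)) (\<Lambda>' d) (a i * b j))"
        using \<Lambda>'(2) by (auto simp: step(1))
      have "\<Lambda>' d \<in> lower_corners (row_rel i) (col_rel j) (\<Lambda> (d - 1)) (\<Lambda> (d + 1))"
        using comp[OF \<Lambda>'(1)] split(2) by (simp add: \<nu>(1))
      then have "\<Lambda>' d = \<kappa>" using \<kappa>(4) \<nu> by simp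
      then show ?thesis by (auto simp: \<nu>(1))
    qed
    have "pmf (bind_pmf p (seq_step w a b (cell k))) \<Lambda> =
        pmf p ?\<Lambda>1 * pmf (seq_step w a b (cell k) ?\<Lambda>1) \<Lambda>"
      by (rule pmf_bind_single[OF uniq])
    also have "pmf p ?\<Lambda>1 = C * path_weight a b n (Suc k) ?\<Lambda>1"
      by (intro law c1 confined_step[OF ij d_def \<Lambda>(2)])
    also have "pmf (seq_step w a b (cell k) ?\<Lambda>1) \<Lambda> =
        (1 - cell_const w a b (i, j)) * (a i * b j) ^ g"
      unfolding step(2) by (rule \<kappa>(3))
    finally show "pmf (bind_pmf p (seq_step w a b (cell k))) \<Lambda> =
        C * (1 - cell_const w a b (cell k)) * path_weight a b n k \<Lambda>"
      unfolding path_weight_step[OF ij d_def \<open>i < n\<close> \<open>j < n\<close> \<Lambda>(1) c1 \<kappa>(2)] ij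
      by (simp only: mult_ac)
  qed
qed

lemma has_path_law_chain:
  assumes "has_path_law m n k C p" and "k \<le> n"
  shows "has_path_law m n 0 (C * (\<Prod>l<k. 1 - cell_const w a b (cell l)))
    (bind_pmf p (seq_chain w a b (cells_below k)))"
  using assms
proof (induction k arbitrary: C p)
  case 0
  then show ?case by (simp add: cells_below_def bind_return_pmf')
next
  case (Suc k)
  then have "has_path_law m n k (C * (1 - cell_const w a b (cell k)))
    (bind_pmf p (seq_step w a b (cell k)))" by (intro has_path_law_step) auto
  from Suc.IH[OF this] Suc.prems(2) show ?case
    by (simp add: cells_below_Suc bind_assoc_pmf mult.assoc mult.commute)
qed

text \<open>Once \<open>(m, m)\<close> is among the first \<open>k\<close> cells, every vertex of the boundary path is beyond row or column \<open>m\<close>, and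
the empty sequence is the only confined one.\<close>
lemma seq_chain_law:
  assumes "cell_index (m, m) < k"
  shows "has_path_law m k 0 (\<Prod>l<k. 1 - cell_const w a b (cell l))
    (seq_chain w a b (cells_below k) (\<lambda>_. empty_part))"
proof -
  have edges: "row_edge k m > 0" "col_edge k m < 0"
    using assms by (auto simp: row_edge_def col_edge_def less_row_len_iff less_col_len_iff)
  have "has_path_law m k k 1 (return_pmf (\<lambda>_. empty_part))"
    unfolding has_path_law_def
  proof (intro conjI ballI allI impI)
    show "compatible w k \<Lambda>" if "\<Lambda> \<in> set_pmf (return_pmf (\<lambda>_. empty_part))" for \<Lambda>
      using that compatible_empty by simp
    fix \<Lambda> assume "confined m k \<Lambda>"
    then have "\<Lambda> x = empty_part" for x
      using edges unfolding confined_def by (metis linorder_less_linear less_trans)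
    then have "\<Lambda> = (\<lambda>_. empty_part)" by auto
    then show "pmf (return_pmf (\<lambda>_. empty_part)) \<Lambda> = 1 * path_weight a b k k \<Lambda>"
      by (simp add: path_weight_def)
  qed
  from has_path_law_chain[OF this] show ?thesis by (simp add: bind_return_pmf)
qed

end

section \<open>From arrays to boundary sequences\<close>

text \<open>The first cell on diagonal \<open>d\<close> that is not in \<open>S\<close>: the vertex of the boundary path of \<open>S\<close> on this diagonal.\<close>
definition front :: "(nat \<times> nat) set \<Rightarrow> int \<Rightarrow> nat \<times> nat" where
  "front S d = (let m = LEAST m. (m + nat (- d), m + nat d) \<notin> S in (m + nat (- d), m + nat d))"

lemma front_eqI:
  assumes "(i, j) \<notin> S" and "\<And>t. 0 < t \<Longrightarrow> t \<le> i \<Longrightarrow> t \<le> j \<Longrightarrow> (i - t, j - t) \<in> S"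
    and d: "d = int j - int i"
  shows "front S d = (i, j)"
proof -
  have ij: "(min i j + nat (- d), min i j + nat d) = (i, j)" using d by auto
  have "(LEAST m. (m + nat (- d), m + nat d) \<notin> S) = min i j"
  proof (rule Least_equality)
    show "(min i j + nat (- d), min i j + nat d) \<notin> S" using assms(1) ij by simp
    fix m assume m: "(m + nat (- d), m + nat d) \<notin> S"
    show "min i j \<le> m"
    proof (rule ccontr)
      assume "\<not> min i j \<le> m"
      moreover define t where "t = min i j - m"
      ultimately have "0 < t" "t \<le> i" "t \<le> j" "(m + nat (- d), m + nat d) = (i - t, j - t)"
        using d by auto
      then show False using assms(2)[of t] m by simp
    qed
  qed
  then show ?thesis using ij by (simp add: front_def)
qed

lemma front_diag: "front S d = (i, j) \<Longrightarrow> d = int j - int i"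
  by (auto simp: front_def Let_def)

lemma front_empty: "front {} d = (nat (- d), nat d)"
  by (simp add: front_def Least_eq_0)

lemma front_insert: "d \<noteq> int j - int i \<Longrightarrow> front (insert (i, j) S) d = front S d"
proof -
  assume "d \<noteq> int j - int i"
  then have "(m + nat (- d), m + nat d) \<noteq> (i, j)" for m by (cases "0 \<le> d") auto
  then show ?thesis by (simp add: front_def)
qed

fun level :: "nat \<times> nat \<Rightarrow> nat" where "level (i, j) = i + j"

text \<open>The lists of pending cells for which the array entries needed by each update are the current values on the
boundary path: lower antidiagonals come last and are complete, while the order within an
antidiagonal is free.\<close>
fun by_levels :: "(nat \<times> nat) list \<Rightarrow> bool" where
  "by_levels [] \<longleftrightarrow> True"
| "by_levels (c # cs) \<longleftrightarrow> by_levels cs \<and> c \<notin> set cs \<and>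
     (\<forall>c'. level c' < level c \<longrightarrow> c' \<in> set cs) \<and> (\<forall>c'\<in>set cs. level c' \<le> level c)"

lemma by_levels_front:
  assumes "by_levels ((i, j) # cs)" and d: "d = int j - int i"
  shows "front (set cs) d = (i, j)" "front (insert (i, j) (set cs)) d = (i + 1, j + 1)"
    "front (set cs) (d - 1) = (i + 1, j)" "front (set cs) (d + 1) = (i, j + 1)"
proof -
  have lower: "(i', j') \<in> set cs" if "i' + j' < i + j" for i' j' using assms(1) that by simp
  have upper: "(i', j') \<notin> set cs" if "i' + j' > i + j" for i' j'
    using assms(1) that by fastforce
  show "front (set cs) d = (i, j)"
    by (rule front_eqI) (use assms lower in auto)
  show "front (insert (i, j) (set cs)) d = (i + 1, j + 1)"
  proof (rule front_eqI)
    fix t assume "0 < t" "t \<le> i + 1" "t \<le> j + 1"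
    then show "(i + 1 - t, j + 1 - t) \<in> insert (i, j) (set cs)"
      by (cases "t = 1") (auto intro: lower)
  qed (use d upper in auto)
  show "front (set cs) (d - 1) = (i + 1, j)"
    by (rule front_eqI) (use d lower upper in auto)
  show "front (set cs) (d + 1) = (i, j + 1)"
    by (rule front_eqI) (use d lower upper in auto)
qed

text \<open>Reading the array along the boundary path of the pending cells turns each array update into a step of the
chain on sequences. When no cell is pending, the path is the one read by the output.\<close>
lemma read_update_cells:
  assumes "by_levels cs"
  shows "map_pmf read_output (update_cells w a b cs \<tau>) =
    seq_chain w a b cs (\<lambda>d. \<tau> (front (set cs) d))"
  using assms
proof (induction cs arbitrary: \<tau>)
  case Nil
  have "read_output \<tau> = (\<lambda>d. \<tau> (front {} d))" by (auto simp: read_output_def front_empty)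
  then show ?case by simp
next
  case (Cons c cs)
  obtain i j where c: "c = (i, j)" by (cases c)
  define d where "d = int j - int i"
  note f = by_levels_front[OF Cons.prems[unfolded c] d_def]
  let ?\<Lambda> = "\<lambda>d. \<tau> (front (insert (i, j) (set cs)) d)"
  have upd: "(\<lambda>d'. (\<tau>((i, j) := \<nu>)) (front (set cs) d')) = ?\<Lambda>(d := \<nu>)" for \<nu>
  proof
    fix d'
    show "(\<tau>((i, j) := \<nu>)) (front (set cs) d') = (?\<Lambda>(d := \<nu>)) d'"
    proof (cases "d' = d")
      case False
      then have "front (set cs) d' \<noteq> (i, j)" using front_diag d_def by blast
      then show ?thesis using False front_insert[of d' j i "set cs"] by (simp add: d_def)
    qed (simp add: f)
  qed
  have \<Lambda>: "?\<Lambda> (d - 1) = \<tau> (i + 1, j)" "?\<Lambda> (d + 1) = \<tau> (i, j + 1)" "?\<Lambda> d = \<tau> (i + 1, j + 1)"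
    using front_insert[of "d - 1" j i "set cs"] front_insert[of "d + 1" j i "set cs"]
    by (simp_all add: f d_def del: One_nat_def)
       (simp_all add: f[unfolded d_def])
  have "map_pmf read_output (update_cells w a b (c # cs) \<tau>) =
      bind_pmf (sample (type_of_cell w i j) (\<tau> (i + 1, j)) (\<tau> (i, j + 1)) (\<tau> (i + 1, j + 1)) (a i * b j))
        (\<lambda>\<nu>. seq_chain w a b cs (\<lambda>d'. (\<tau>((i, j) := \<nu>)) (front (set cs) d')))"
    using Cons by (simp add: c update_cell_def bind_map_pmf map_bind_pmf)
  also have "\<dots> = seq_chain w a b (c # cs) ?\<Lambda>"
    unfolding upd \<Lambda>[symmetric] by (simp add: c seq_step_def Let_def bind_map_pmf d_def)
  finally show ?case by (simp add: c)
qed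

section \<open>Reordering independent cells\<close>

lemma seq_step_commute:
  assumes "\<bar>(int j - int i) - (int j' - int i')\<bar> \<ge> 2"
  shows "bind_pmf (seq_step w a b (i, j) \<Lambda>) (seq_step w a b (i', j')) =
    bind_pmf (seq_step w a b (i', j') \<Lambda>) (seq_step w a b (i, j))"
proof -
  define d d' where "d = int j - int i" and "d' = int j' - int i'"
  have ne: "d' - 1 \<noteq> d" "d' + 1 \<noteq> d" "d' \<noteq> d" "d - 1 \<noteq> d'" "d + 1 \<noteq> d'" "d \<noteq> d'"
    using assms by (auto simp: d_def d'_def)
  let ?p = "sample (type_of_cell w i j) (\<Lambda> (d - 1)) (\<Lambda> (d + 1)) (\<Lambda> d) (a i * b j)"
  let ?q = "sample (type_of_cell w i' j') (\<Lambda> (d' - 1)) (\<Lambda> (d' + 1)) (\<Lambda> d') (a i' * b j')"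
  have "bind_pmf (seq_step w a b (i, j) \<Lambda>) (seq_step w a b (i', j')) =
      bind_pmf ?p (\<lambda>\<nu>. bind_pmf ?q (\<lambda>\<nu>'. return_pmf (\<Lambda>(d := \<nu>, d' := \<nu>'))))"
    using ne by (simp add: seq_step_def Let_def bind_map_pmf map_pmf_def d_def[symmetric]
        d'_def[symmetric] bind_return_pmf bind_assoc_pmf)
  also have "\<dots> = bind_pmf ?q (\<lambda>\<nu>'. bind_pmf ?p (\<lambda>\<nu>. return_pmf (\<Lambda>(d := \<nu>, d' := \<nu>'))))"
    by (rule bind_commute_pmf)
  also have "\<dots> = bind_pmf ?q (\<lambda>\<nu>'. bind_pmf ?p (\<lambda>\<nu>. return_pmf (\<Lambda>(d' := \<nu>', d := \<nu>))))"
    using ne by (simp add: fun_upd_twist)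
  also have "\<dots> = bind_pmf (seq_step w a b (i', j') \<Lambda>) (seq_step w a b (i, j))"
    using ne by (simp add: seq_step_def Let_def bind_map_pmf map_pmf_def d_def[symmetric]
        d'_def[symmetric] bind_return_pmf bind_assoc_pmf)
  finally show ?thesis .
qed

lemma seq_chain_append:
  "seq_chain w a b (xs @ ys) \<Lambda> = bind_pmf (seq_chain w a b xs \<Lambda>) (seq_chain w a b ys)"
  by (induction xs arbitrary: \<Lambda>)
     (auto simp: bind_return_pmf bind_assoc_pmf intro!: bind_pmf_cong)

lemma seq_chain_Cons:
  "seq_chain w a b (c # cs) = (\<lambda>\<Lambda>. bind_pmf (seq_step w a b c \<Lambda>) (seq_chain w a b cs))"
  by (rule ext) simp

lemma level_commute:
  assumes "level c = level c'" "c \<noteq> c'"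
  shows "bind_pmf (seq_step w a b c \<Lambda>) (seq_step w a b c') =
    bind_pmf (seq_step w a b c' \<Lambda>) (seq_step w a b c)"
proof -
  obtain i j i' j' where c: "c = (i, j)" "c' = (i', j')" by (cases c; cases c')
  show ?thesis unfolding c by (rule seq_step_commute) (use assms c in auto)
qed

lemma seq_chain_move:
  assumes "\<And>x. x \<in> set xs \<Longrightarrow> level x = level c \<and> x \<noteq> c"
  shows "seq_chain w a b (c # xs @ ys) \<Lambda> = seq_chain w a b (xs @ c # ys) \<Lambda>"
  using assms
proof (induction xs arbitrary: \<Lambda>)
  case (Cons x xs)
  have "seq_chain w a b (c # (x # xs) @ ys) \<Lambda> =
      bind_pmf (bind_pmf (seq_step w a b c \<Lambda>) (seq_step w a b x)) (seq_chain w a b (xs @ ys))"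
    by (simp add: bind_assoc_pmf seq_chain_Cons)
  also have "bind_pmf (seq_step w a b c \<Lambda>) (seq_step w a b x) =
      bind_pmf (seq_step w a b x \<Lambda>) (seq_step w a b c)"
    by (rule level_commute) (use Cons.prems[of x] in auto)
  also have "bind_pmf \<dots> (seq_chain w a b (xs @ ys)) =
      bind_pmf (seq_step w a b x \<Lambda>) (\<lambda>\<Lambda>. seq_chain w a b (c # xs @ ys) \<Lambda>)"
    by (simp add: bind_assoc_pmf)
  also have "\<dots> = seq_chain w a b ((x # xs) @ c # ys) \<Lambda>"
    using Cons by simp
  finally show ?case .
qed simp

text \<open>The algorithm traverses each antidiagonal by increasing \<open>j\<close>, whereas decreasing \<open>cell_index\<close> means decreasing
\<open>j\<close>. Both orders give the same law: cells of one antidiagonal lie on diagonals that differ by at least 2,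
so each is sampled without looking at the others.\<close>
lemma seq_chain_rev:
  assumes "distinct xs" "\<And>x. x \<in> set xs \<Longrightarrow> level x = n"
  shows "seq_chain w a b (rev xs @ ys) \<Lambda> = seq_chain w a b (xs @ ys) \<Lambda>"
  using assms
proof (induction xs arbitrary: ys)
  case (Cons x xs)
  have "seq_chain w a b (rev (x # xs) @ ys) \<Lambda> = seq_chain w a b (xs @ x # ys) \<Lambda>"
    using Cons.IH[of "x # ys"] Cons.prems by simp
  also have "\<dots> = seq_chain w a b (x # xs @ ys) \<Lambda>"
    by (rule seq_chain_move[symmetric]) (use Cons.prems in auto)
  finally show ?case by simp
qed simp

definition antidiagonal :: "nat \<Rightarrow> nat \<Rightarrow> (nat \<times> nat) list" where
  "antidiagonal n m = map (\<lambda>j. (n - j, j)) [0..<m]"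

primrec antidiagonals :: "nat \<Rightarrow> (nat \<times> nat) list" where
  "antidiagonals 0 = []"
| "antidiagonals (Suc n) = antidiagonal n (Suc n) @ antidiagonals n"

lemma cells_after_eq: "cells_after (i, j) = antidiagonal (i + j) j @ antidiagonals (i + j)"
proof -
  \<comment> \<open>Only on the starting antidiagonal the range of \<open>j\<close> is cut off.\<close>
  have block: "concat (map (\<lambda>x. if \<not> (n = i + j \<and> j \<le> x) then [(n - x, x)] else []) [0..<k]) =
      antidiagonal n (if n = i + j then min j k else k)" for n k
    by (induction k) (auto simp: antidiagonal_def min_def le_Suc_eq)
  have tail: "concat (map (\<lambda>n. antidiagonal n (if n = i + j then min j (n + 1) else n + 1)) (rev [0..<m])) =
      antidiagonals m" if "m \<le> i + j" for m
    using that by (induction m) auto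
  show ?thesis
    unfolding cells_after_def Let_def prod.case block using tail[of "i + j"] by simp
qed

lemma antidiagonal_props:
  "m \<le> Suc n \<Longrightarrow> distinct (antidiagonal n m) \<and> (\<forall>c\<in>set (antidiagonal n m). level c = n)"
  by (auto simp: antidiagonal_def distinct_map inj_on_def)

lemma set_antidiagonal: "set (antidiagonal n (Suc n)) = {c. level c = n}"
proof -
  have "(i, j) \<in> set (antidiagonal n (Suc n)) \<longleftrightarrow> i + j = n" for i j
    by (auto simp: antidiagonal_def image_iff)
  then show ?thesis by auto
qed

lemma by_levels_append:
  assumes "by_levels cs" "set cs = {c. level c < n}" "distinct xs" "\<And>c. c \<in> set xs \<Longrightarrow> level c = n"
  shows "by_levels (xs @ cs)"
  using assms(3,4)
  by (induction xs) (use assms(1,2) in \<open>auto simp: less_imp_le\<close>)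

lemma by_levels_antidiagonals:
  "by_levels (antidiagonals n) \<and> set (antidiagonals n) = {c. level c < n}"
proof (induction n)
  case (Suc n)
  have "by_levels (antidiagonal n (Suc n) @ antidiagonals n)"
    by (rule by_levels_append[where n = n])
       (use Suc antidiagonal_props[of "Suc n" n] in \<open>simp_all only: le_refl simp_thms\<close>)
  moreover have "{c. level c = n} \<union> {c. level c < n} = {c. level c < Suc n}" by (auto simp del: level.simps)
  ultimately show ?case using Suc by (simp only: antidiagonals.simps set_append set_antidiagonal simp_thms)
qed simp

lemma cell_triangle: "j \<le> n \<Longrightarrow> cell (triangle n + j) = (n - j, j)"
  by (simp add: cell_eq_iff cell_index_triangle)

lemma cells_below_triangle:
  "m \<le> Suc n \<Longrightarrow> cells_below (triangle n + m) = rev (antidiagonal n m) @ cells_below (triangle n)"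
proof (induction m)
  case (Suc m)
  then show ?case by (simp add: cells_below_Suc cell_triangle antidiagonal_def)
qed (simp add: antidiagonal_def)

lemma seq_chain_antidiagonals:
  "seq_chain w a b (antidiagonals n) \<Lambda> = seq_chain w a b (cells_below (triangle n)) \<Lambda>"
proof (induction n arbitrary: \<Lambda>)
  case (Suc n)
  have "seq_chain w a b (antidiagonals n) = seq_chain w a b (cells_below (triangle n))"
    by (rule ext) (rule Suc)
  then have "seq_chain w a b (antidiagonals (Suc n)) \<Lambda> =
      seq_chain w a b (antidiagonal n (Suc n) @ cells_below (triangle n)) \<Lambda>"
    by (simp add: seq_chain_append)
  also have "\<dots> = seq_chain w a b (rev (antidiagonal n (Suc n)) @ cells_below (triangle n)) \<Lambda>"
    by (rule seq_chain_rev[symmetric, of _ n]) (use antidiagonal_props[of "Suc n" n] in auto)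
  also have "\<dots> = seq_chain w a b (cells_below (triangle (Suc n))) \<Lambda>"
    using cells_below_triangle[of "Suc n" n] by (simp add: triangle_Suc)
  finally show ?case .
qed (simp add: cells_below_def)

lemma seq_chain_cells_after:
  "seq_chain w a b (cells_after c) \<Lambda> = seq_chain w a b (cells_below (cell_index c)) \<Lambda>"
proof -
  obtain i j where c: "c = (i, j)" by (cases c)
  have eq: "cells_after c = antidiagonal (i + j) j @ antidiagonals (i + j)"
    by (simp add: c cells_after_eq)
  have "seq_chain w a b (antidiagonals n) = seq_chain w a b (cells_below (triangle n))" for n
    by (rule ext) (rule seq_chain_antidiagonals)
  then have "seq_chain w a b (cells_after c) \<Lambda> =
      seq_chain w a b (antidiagonal (i + j) j @ cells_below (triangle (i + j))) \<Lambda>"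
    unfolding eq by (simp add: seq_chain_append)
  also have "\<dots> = seq_chain w a b (rev (antidiagonal (i + j) j) @ cells_below (triangle (i + j))) \<Lambda>"
    by (rule seq_chain_rev[symmetric, of _ "i + j"]) (use antidiagonal_props[of j "i + j"] in auto)
  also have "\<dots> = seq_chain w a b (cells_below (cell_index c)) \<Lambda>"
    using cells_below_triangle[of j "i + j"] by (simp add: c cell_index_triangle)
  finally show ?thesis .
qed

lemma by_levels_cells_after: "by_levels (c # cells_after c)"
proof -
  obtain i j where c: "c = (i, j)" by (cases c)
  have eq: "cells_after c = antidiagonal (i + j) j @ antidiagonals (i + j)"
    by (simp add: c cells_after_eq)
  have "c \<notin> set (antidiagonal (i + j) j)" by (auto simp: c antidiagonal_def)
  then have "by_levels ((c # antidiagonal (i + j) j) @ antidiagonals (i + j))"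
    using by_levels_antidiagonals[of "i + j"] antidiagonal_props[of j "i + j"]
    by (intro by_levels_append[where n = "i + j"]) (auto simp: c simp del: by_levels.simps)
  then show ?thesis by (simp only: eq append_Cons)
qed

lemma run_from_first_cell:
  fixes i j
  defines "d \<equiv> int j - int i"
  shows "map_pmf read_output (update_cells w a b (cells_after (i, j)) ((\<lambda>_. empty_part)((i, j) := \<nu>))) =
    seq_chain w a b (cells_below (cell_index (i, j))) ((\<lambda>_. empty_part)(d := \<nu>))"
proof -
  let ?S = "set (cells_after (i, j))"
  have "((\<lambda>_. empty_part)((i, j) := \<nu>)) (front ?S x) = ((\<lambda>_. empty_part)(d := \<nu>)) x" for x
  proof (cases "x = d")
    case True
    then show ?thesis
      by (simp add: d_def by_levels_front(1)[OF by_levels_cells_after refl])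
  next
    case False
    then have "front ?S x \<noteq> (i, j)" using front_diag[of ?S x i j] unfolding d_def by blast
    then show ?thesis using False by simp
  qed
  then have "(\<lambda>x. ((\<lambda>_. empty_part)((i, j) := \<nu>)) (front ?S x)) = (\<lambda>_. empty_part)(d := \<nu>)" ..
  then show ?thesis
    using read_update_cells[of "cells_after (i, j)" w a b "(\<lambda>_. empty_part)((i, j) := \<nu>)"]
      by_levels_cells_after[of "(i, j)"] by (simp add: seq_chain_cells_after)
qed

section \<open>The first nonempty cell\<close>

lemma one_row_0: "one_row 0 = empty_part"
  by (auto simp: one_row_def empty_part_def)

lemma map_Not_bernoulli:
  assumes "0 \<le> p" "p \<le> 1" shows "map_pmf Not (bernoulli_pmf p) = bernoulli_pmf (1 - p)"
proof (rule pmf_eqI)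
  fix x
  have "pmf (map_pmf Not (bernoulli_pmf p)) (Not (\<not> x)) = pmf (bernoulli_pmf p) (\<not> x)"
    by (rule pmf_map_inj') (auto simp: inj_def)
  then show "pmf (map_pmf Not (bernoulli_pmf p)) x = pmf (bernoulli_pmf (1 - p)) x"
    using assms by (cases x) simp_all
qed

context pyramid
begin

lemma cell_const_bounds: "0 \<le> cell_const w a b c" "cell_const w a b c < 1"
proof -
  obtain i j where c: "c = (i, j)" by (cases c)
  have "type_of_cell w i j \<in> {HH, VV} \<Longrightarrow> a i * b j < 1"
    using ab_less_1[of i j]
    by (cases rule: row_rel_cases[of i]; cases rule: col_rel_cases[of j]) (auto simp: type_of_cell_def)
  then show "0 \<le> cell_const w a b c" "cell_const w a b c < 1"
    using ab_nonneg[of i j] by (auto simp: c cell_const_def)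
qed

text \<open>With empty neighbours the draw is visible in the output: it is zero with probability \<open>1 - c\<close>, and
\<open>sample_first\<close> is its law conditioned on being nonzero. For the geometric law this is the absence of
memory.\<close>
lemma sample_from_empty:
  "sample (type_of_cell w i j) empty_part empty_part empty_part (a i * b j) =
     bind_pmf (bernoulli_pmf (1 - cell_const w a b (i, j))) (\<lambda>z.
       if z then return_pmf empty_part else sample_first (type_of_cell w i j) (a i * b j))"
proof -
  let ?\<xi> = "a i * b j" and ?c = "cell_const w a b (i, j)"
  have c: "0 \<le> ?c" "?c < 1" by (rule cell_const_bounds)+
  have HH: "sampleHH empty_part empty_part empty_part \<xi> = map_pmf one_row (Geom \<xi>)" for \<xi>
    unfolding sampleHH_eq
    by (rule map_pmf_cong[OF refl]) (auto simp: growHH_def one_row_def empty_part_def split: nat.split)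
  have geom: "map_pmf one_row (Geom \<xi>) = bind_pmf (bernoulli_pmf (1 - \<xi>)) (\<lambda>z.
      if z then return_pmf empty_part else map_pmf (\<lambda>G. one_row (1 + G)) (Geom \<xi>))"
    if "0 \<le> \<xi>" "\<xi> < 1" for \<xi>
    by (subst geometric_bind_pmf_unfold)
      (use that in \<open>auto simp: map_bind_pmf one_row_0 map_pmf_comp intro!: bind_pmf_cong\<close>)
  have HV: "sampleHV empty_part empty_part empty_part \<xi> = map_pmf one_row (Bernoulli (\<xi> / (1 + \<xi>)))" for \<xi>
    unfolding sampleHV_eq[OF is_partition_empty is_partition_empty]
    by (rule map_pmf_cong[OF refl])
       (auto simp: growHV_def live_carry_def slot_def one_row_def empty_part_def)
  have bern: "map_pmf one_row (Bernoulli p) = bind_pmf (bernoulli_pmf (1 - p)) (\<lambda>z.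
      if z then return_pmf empty_part else return_pmf (one_row 1))" if "0 \<le> p" "p \<le> 1" for p
    unfolding map_Not_bernoulli[OF that, symmetric]
    by (auto simp: map_pmf_def bind_assoc_pmf bind_return_pmf one_row_0 intro!: bind_pmf_cong)
  show ?thesis
  proof (cases "type_of_cell w i j")
    case T: HH
    then have "?c = ?\<xi>" by (simp add: cell_const_def)
    then show ?thesis using c geom[of ?\<xi>] unfolding T by (simp add: HH cong: if_cong)
  next
    case T: VV
    then have "?c = ?\<xi>" by (simp add: cell_const_def)
    then show ?thesis using c unfolding T
      by (auto simp: sampleVV_def conj_empty HH geom map_bind_pmf map_pmf_comp intro!: bind_pmf_cong)
  next
    case T: HV
    then have "?c = ?\<xi> / (1 + ?\<xi>)" by (simp add: cell_const_def)
    then show ?thesis using c bern[of ?c] unfolding T by (simp add: HV cong: if_cong)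
  next
    case T: VH
    then have "?c = ?\<xi> / (1 + ?\<xi>)" by (simp add: cell_const_def)
    then show ?thesis using c bern[of ?c] unfolding T by (simp add: sampleVH_def HV cong: if_cong)
  qed
qed

text \<open>Think of independent draws in all cells, almost surely finitely many of them nonzero. Then \<open>run_below k\<close> is the law
of the output if the draws in the cells of index at least \<open>k\<close> are zero, and \<open>run_from k\<close> its law if cell \<open>k\<close> has
the last nonzero draw.\<close>
definition run_below :: "nat \<Rightarrow> partition_seq pmf" where
  "run_below k = seq_chain w a b (cells_below k) (\<lambda>_. empty_part)"

definition run_from :: "nat \<Rightarrow> partition_seq pmf" where
  "run_from k = (case cell k of (i, j) \<Rightarrow>
     bind_pmf (sample_first (type_of_cell w i j) (a i * b j)) (\<lambda>\<nu>.
       map_pmf read_output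
         (update_cells w a b (cells_after (i, j)) ((\<lambda>_. empty_part)((i, j) := \<nu>)))))"

lemma run_below_Suc:
  "run_below (Suc k) = bind_pmf (bernoulli_pmf (1 - cell_const w a b (cell k)))
     (\<lambda>z. if z then run_below k else run_from k)"
proof -
  obtain i j where ij: "cell k = (i, j)" by (cases "cell k")
  let ?d = "int j - int i" and ?e = "\<lambda>_::int. empty_part"
  have upd: "?e(?d := empty_part) = ?e" by auto
  have "run_below (Suc k) =
      bind_pmf (sample (type_of_cell w i j) empty_part empty_part empty_part (a i * b j))
        (\<lambda>\<nu>. seq_chain w a b (cells_below k) (?e(?d := \<nu>)))"
    by (simp add: run_below_def cells_below_Suc ij seq_step_def Let_def bind_map_pmf)
  also have "\<dots> = bind_pmf (bernoulli_pmf (1 - cell_const w a b (i, j))) (\<lambda>z. if z then run_below k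
      else bind_pmf (sample_first (type_of_cell w i j) (a i * b j))
        (\<lambda>\<nu>. seq_chain w a b (cells_below k) (?e(?d := \<nu>))))"
    unfolding sample_from_empty bind_assoc_pmf
    by (intro bind_pmf_cong refl) (simp add: bind_return_pmf upd run_below_def)
  also have "bind_pmf (sample_first (type_of_cell w i j) (a i * b j))
        (\<lambda>\<nu>. seq_chain w a b (cells_below k) (?e(?d := \<nu>))) = run_from k"
    using ij by (simp add: run_from_def run_from_first_cell cell_eq_iff)
  finally show ?thesis by (simp add: ij)
qed

lemma pmf_run_below_Suc:
  "pmf (run_below (Suc k)) \<Lambda> = (1 - cell_const w a b (cell k)) * pmf (run_below k) \<Lambda> +
     cell_const w a b (cell k) * pmf (run_from k) \<Lambda>"
  using cell_const_bounds[of "cell k"] unfolding run_below_Suc pmf_bind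
  by (subst integral_bernoulli_pmf) auto

end

section \<open>The infinite product and the output law\<close>

lemma has_sum_pmf: "(pmf p has_sum 1) UNIV"
proof -
  have "pmf p summable_on UNIV"
    using abs_summable_summable abs_summable_equivalent pmf_abs_summable by blast
  moreover have "infsum (pmf p) UNIV = 1"
    using infsetsum_infsum[OF pmf_abs_summable] infsetsum_pmf_eq_1[of p UNIV] by (metis subset_UNIV)
  ultimately show ?thesis using has_sum_infsum by force
qed

lemma embed_pmf_pmf: "embed_pmf (pmf p) = p"
  by (rule type_definition.Rep_inverse[OF td_pmf_embed_pmf])

lemma pmf_bind_nat_sums:
  fixes q :: "nat pmf"
  shows "(\<lambda>n. pmf q n * pmf (f n) y) sums pmf (bind_pmf q f) y"
proof -
  have nn: "0 \<le> pmf q n * pmf (f n) y" for n by simp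
  have le: "pmf q n * pmf (f n) y \<le> pmf q n" for n by (simp add: pmf_le_1 mult_left_le)
  have summable: "summable (\<lambda>n. pmf q n * pmf (f n) y)"
  proof (rule summableI_nonneg_bounded[OF nn])
    fix n
    have "(\<Sum>i<n. pmf q i * pmf (f i) y) \<le> (\<Sum>i<n. pmf q i)" by (rule sum_mono) (rule le)
    also have "\<dots> \<le> 1" by (simp flip: measure_measure_pmf_finite)
    finally show "(\<Sum>i<n. pmf q i * pmf (f i) y) \<le> 1" .
  qed
  have "ennreal (pmf (bind_pmf q f) y) = (\<Sum>n. ennreal (pmf q n) * ennreal (pmf (f n) y))"
    by (simp add: ennreal_pmf_bind nn_integral_measure_pmf nn_integral_count_space_nat)
  also have "\<dots> = (\<Sum>n. ennreal (pmf q n * pmf (f n) y))" by (simp add: ennreal_mult)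
  also have "\<dots> = ennreal (\<Sum>n. pmf q n * pmf (f n) y)"
    by (rule suminf_ennreal2[OF nn summable])
  finally have "pmf (bind_pmf q f) y = (\<Sum>n. pmf q n * pmf (f n) y)"
    using suminf_nonneg[OF summable nn] by simp
  then show ?thesis using summable summable_sums by metis
qed

text \<open>Taking logarithms reduces unordered products to unordered sums.\<close>
lemma infprod_exp:
  assumes "((\<lambda>x. ln (f x)) has_sum S) A" and "\<And>x. x \<in> A \<Longrightarrow> 0 < f x"
  shows "infprod f A = exp S"
proof -
  have "((\<lambda>F. exp (\<Sum>x\<in>F. ln (f x))) \<longlongrightarrow> exp S) (finite_subsets_at_top A)"
    using assms(1) unfolding has_sum_def by (rule tendsto_exp)
  moreover have "\<forall>\<^sub>F F in finite_subsets_at_top A. exp (\<Sum>x\<in>F. ln (f x)) = prod f F"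
  proof (rule eventually_finite_subsets_at_top_weakI)
    fix F assume "finite F" "F \<subseteq> A"
    then show "exp (\<Sum>x\<in>F. ln (f x)) = prod f F"
      unfolding exp_sum[OF \<open>finite F\<close>] by (intro prod.cong) (auto simp: assms(2) subset_eq)
  qed
  ultimately have "(prod f \<longlongrightarrow> exp S) (finite_subsets_at_top A)"
    by (rule Lim_transform_eventually)
  then show ?thesis unfolding infprod_def by (intro tendsto_Lim) simp_all
qed

context pyramid
begin

definition cell_prob :: "nat \<Rightarrow> real" where "cell_prob k = cell_const w a b (cell k)"

definition tail_prod :: "nat \<Rightarrow> real" where
  "tail_prod k = infprod (\<lambda>c. 1 - cell_const w a b c) {c. k \<le> cell_index c}"

lemma cell_prob_bounds: "0 \<le> cell_prob k" "cell_prob k < 1"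
  using cell_const_bounds by (auto simp: cell_prob_def)

text \<open>Every partial sum is dominated by \<open>(\<Sum>i. a i) * (\<Sum>j. b j)\<close>.\<close>
lemma summable_cell_prob: "summable cell_prob"
proof -
  have sa: "summable a" and sb: "summable b"
    by (rule summable_comparison_test'[OF summable_ab]; simp add: a_nonneg b_nonneg)+
  show ?thesis
  proof (rule summableI_nonneg_bounded[OF cell_prob_bounds(1)])
    fix n
    let ?f = "\<lambda>c. a (fst c) * b (snd c)"
    have "x / (1 + x) \<le> x" if "0 \<le> x" for x :: real
      using that by (simp add: divide_le_eq algebra_simps)
    then have "cell_prob k \<le> ?f (cell k)" for k
      using ab_nonneg[of "fst (cell k)" "snd (cell k)"]
      by (simp add: cell_prob_def cell_const_def case_prod_unfold)
    then have "(\<Sum>k<n. cell_prob k) \<le> (\<Sum>k<n. ?f (cell k))" by (rule sum_mono)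
    also have "\<dots> = sum ?f (cell ` {..<n})"
      by (rule sum.reindex_cong[symmetric, of cell]) (auto intro: inj_on_inverseI[where g = cell_index])
    also have "\<dots> \<le> sum ?f ({..<n} \<times> {..<n})"
    proof (rule sum_mono2)
      show "cell ` {..<n} \<subseteq> {..<n} \<times> {..<n}"
      proof
        fix c assume "c \<in> cell ` {..<n}"
        then obtain k where "k < n" "cell k = (fst c, snd c)" by auto
        then show "c \<in> {..<n} \<times> {..<n}"
          using cell_le[of k "fst c" "snd c"] by (simp add: mem_Times_iff)
      qed
    qed (use ab_nonneg in auto)
    also have "\<dots> = sum a {..<n} * sum b {..<n}"
      by (simp add: sum_product sum.cartesian_product case_prod_unfold)
    also have "\<dots> \<le> suminf a * suminf b"
      using sum_le_suminf[OF sa] sum_le_suminf[OF sb] a_nonneg b_nonneg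
      by (intro mult_mono) (auto intro: sum_nonneg suminf_nonneg sa)
    finally show "(\<Sum>k<n. cell_prob k) \<le> suminf a * suminf b" .
  qed
qed

definition cost :: "nat \<Rightarrow> real" where "cost k = - ln (1 - cell_prob k)"

lemma cost_nonneg: "0 \<le> cost k"
  using cell_prob_bounds[of k] by (simp add: cost_def)

lemma summable_cost: "summable cost"
proof (rule summable_comparison_test_ev)
  have "cell_prob \<longlonglongrightarrow> 0" by (rule summable_LIMSEQ_zero[OF summable_cell_prob])
  then have "\<forall>\<^sub>F k in sequentially. cell_prob k < 1 / 2" by (rule order_tendstoD) simp
  then show "\<forall>\<^sub>F k in sequentially. norm (cost k) \<le> 2 * cell_prob k"
  proof eventually_elim
    case (elim k)
    have "- cell_prob k - 2 * (cell_prob k)\<^sup>2 \<le> ln (1 - cell_prob k)"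
      using cell_prob_bounds[of k] elim by (intro ln_one_minus_pos_lower_bound) auto
    moreover have "2 * (cell_prob k)\<^sup>2 \<le> cell_prob k"
      using cell_prob_bounds[of k] elim mult_left_mono[of "2 * cell_prob k" 1 "cell_prob k"] by (simp add: power2_eq_square)
    ultimately show ?case using cost_nonneg[of k] by (simp add: cost_def)
  qed
  show "summable (\<lambda>k. 2 * cell_prob k)" by (rule summable_mult[OF summable_cell_prob])
qed

lemma tail_prod_eq: "tail_prod k = exp (- (\<Sum>l. cost (l + k)))"
  unfolding tail_prod_def
proof (rule infprod_exp)
  have sm: "summable (\<lambda>l. cost (l + k))" using summable_cost by (simp add: summable_iff_shift)
  have "((\<lambda>l. - cost (l + k)) has_sum - (\<Sum>l. cost (l + k))) UNIV"
    by (rule norm_summable_imp_has_sum)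
      (use sm cost_nonneg sums_minus[OF summable_sums[OF sm]] in simp_all)
  moreover have "bij_betw (\<lambda>l. cell (l + k)) UNIV {c. k \<le> cell_index c}"
    by (rule bij_betwI[where g = "\<lambda>c. cell_index c - k"]) auto
  ultimately show "((\<lambda>c. ln (1 - cell_const w a b c)) has_sum - (\<Sum>l. cost (l + k))) {c. k \<le> cell_index c}"
    by (subst has_sum_reindex_bij_betw[symmetric]) (auto simp: cost_def cell_prob_def)
qed (use cell_const_bounds in simp)

lemma tail_prod_pos: "0 < tail_prod k"
  by (simp add: tail_prod_eq)

lemma tail_prod_Suc: "tail_prod k = (1 - cell_prob k) * tail_prod (Suc k)"
proof -
  have "summable (\<lambda>l. cost (l + k))" using summable_cost by (simp add: summable_iff_shift)
  from suminf_split_head[OF this]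
  have "(\<Sum>l. cost (l + k)) = (\<Sum>l. cost (l + Suc k)) + cost k" by simp
  moreover have "exp (- cost k) = 1 - cell_prob k" using cell_prob_bounds[of k] by (simp add: cost_def)
  moreover from calculation(1) have "tail_prod k = exp (- cost k) * tail_prod (Suc k)"
    by (simp add: tail_prod_eq flip: exp_add)
  ultimately show ?thesis by simp
qed

lemma tail_prod_LIMSEQ: "tail_prod \<longlonglongrightarrow> 1"
proof -
  have "(\<lambda>k. suminf cost - (\<Sum>i<k. cost i)) \<longlonglongrightarrow> suminf cost - suminf cost"
    by (intro tendsto_diff tendsto_const summable_LIMSEQ summable_cost)
  then have "(\<lambda>k. exp (- (\<Sum>l. cost (l + k)))) \<longlonglongrightarrow> exp (- 0)"
    unfolding suminf_minus_initial_segment[OF summable_cost] by (intro tendsto_intros) simp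
  then show ?thesis by (simp add: tail_prod_eq[abs_def])
qed

lemma tail_prod_0: "tail_prod 0 = tail_prod k * (\<Prod>l<k. 1 - cell_prob l)"
proof (induction k)
  case (Suc k)
  then show ?case using tail_prod_Suc[of k] by simp
qed simp

subsection \<open>The distribution of the first index\<close>

text \<open>The probabilities of the possible values of \<open>K\<close>, where 0 stands for minus infinity and \<open>Suc k\<close> for \<open>k\<close>. They
sum to 1 by telescoping, since \<open>cell_prob k * tail_prod (Suc k) = tail_prod (Suc k) - tail_prod k\<close>.\<close>
definition start_mass :: "nat \<Rightarrow> real" where
  "start_mass n = (case n of 0 \<Rightarrow> tail_prod 0 | Suc k \<Rightarrow> cell_prob k * tail_prod (Suc k))"

lemma start_mass_nonneg: "0 \<le> start_mass n"
  using tail_prod_pos cell_prob_bounds by (auto simp: start_mass_def less_imp_le split: nat.split)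

lemma sum_start_mass: "(\<Sum>n<Suc k. start_mass n) = tail_prod k"
proof (induction k)
  case (Suc k)
  have "(\<Sum>n<Suc (Suc k). start_mass n) = tail_prod k + start_mass (Suc k)"
    using Suc by simp
  also have "\<dots> = tail_prod (Suc k)"
    using tail_prod_Suc[of k] by (simp add: start_mass_def algebra_simps)
  finally show ?case .
qed (simp add: start_mass_def)

lemma start_mass_sums: "start_mass sums 1"
  unfolding sums_def
  by (rule LIMSEQ_imp_Suc) (simp only: sum_start_mass tail_prod_LIMSEQ)

definition start_pmf :: "nat pmf" where "start_pmf = embed_pmf start_mass"

lemma pmf_start_pmf: "pmf start_pmf n = start_mass n"
  unfolding start_pmf_def
proof (rule pmf_embed_pmf[OF start_mass_nonneg])
  show "(\<integral>\<^sup>+n. ennreal (start_mass n) \<partial>count_space UNIV) = 1"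
    using start_mass_sums start_mass_nonneg
    by (simp add: nn_integral_count_space_nat suminf_ennreal2 sums_iff)
qed

definition option_of_nat :: "nat \<Rightarrow> nat option" where
  "option_of_nat n = (case n of 0 \<Rightarrow> None | Suc k \<Rightarrow> Some k)"

lemma inj_option_of_nat: "inj option_of_nat"
  by (auto simp: inj_def option_of_nat_def split: nat.splits)

text \<open>The prescribed distribution function determines the law of \<open>K\<close>, so the description that defines \<open>K_pmf\<close>
picks out the law constructed here.\<close>
lemma K_pmf_eq: "K_pmf w a b = map_pmf option_of_nat start_pmf"
proof -
  define law where "law = (\<lambda>p. (\<forall>k. measure_pmf.prob p (insert None (Some ` {..k})) =
            infprod (\<lambda>c. 1 - cell_const w a b c) {c. cell_index c > k}) \<and>
     pmf p None = infprod (\<lambda>c. 1 - cell_const w a b c) UNIV)"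
  have law_iff: "law p \<longleftrightarrow> (\<forall>k. measure_pmf.prob p (insert None (Some ` {..k})) = tail_prod (Suc k)) \<and>
      pmf p None = tail_prod 0" for p
    by (simp add: law_def tail_prod_def Suc_le_eq)
  have ex: "law (map_pmf option_of_nat start_pmf)"
    unfolding law_iff
  proof (intro conjI allI)
    fix k
    have "option_of_nat -` insert None (Some ` {..k}) = {..<Suc (Suc k)}"
      by (auto simp: option_of_nat_def less_Suc_eq_le split: nat.splits)
    then show "measure_pmf.prob (map_pmf option_of_nat start_pmf) (insert None (Some ` {..k})) =
        tail_prod (Suc k)"
      using sum_start_mass[of "Suc k"] by (simp add: measure_measure_pmf_finite pmf_start_pmf)
    show "pmf (map_pmf option_of_nat start_pmf) None = tail_prod 0"
      using pmf_map_inj'[OF inj_option_of_nat, of start_pmf 0]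
      by (simp add: option_of_nat_def pmf_start_pmf start_mass_def)
  qed
  have Some_mass: "pmf p (Some k) = tail_prod (Suc k) - tail_prod k" if "law p" for p k
  proof -
    have "measure_pmf.prob p (insert None (Some ` {..<k})) = tail_prod k"
      using that by (cases k) (auto simp: law_iff measure_pmf_single lessThan_Suc_atMost)
    moreover have "{..k} = insert k {..<k}" by auto
    then have "measure_pmf.prob p (insert None (Some ` {..k})) =
        pmf p (Some k) + measure_pmf.prob p (insert None (Some ` {..<k}))"
      by (simp add: measure_measure_pmf_finite insert_commute image_iff)
    ultimately show ?thesis using that by (simp add: law_iff)
  qed
  have "p = map_pmf option_of_nat start_pmf" if "law p" for p
  proof (rule pmf_eqI)
    fix x show "pmf p x = pmf (map_pmf option_of_nat start_pmf) x"
      using that ex Some_mass by (cases x) (auto simp: law_iff)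
  qed
  then show ?thesis unfolding K_pmf_def law_def[symmetric] using ex by blast
qed

subsection \<open>The output distribution\<close>

lemma unbounded_schur_sample_eq:
  "unbounded_schur_sample w a b = bind_pmf start_pmf
     (\<lambda>n. case n of 0 \<Rightarrow> run_below 0 | Suc k \<Rightarrow> run_from k)"
  unfolding unbounded_schur_sample_def K_pmf_eq bind_map_pmf inv_cell_index
  by (rule bind_pmf_cong[OF refl])
     (auto simp: option_of_nat_def run_below_def cells_below_def run_from_def Let_def split: nat.split)

text \<open>The partial sums of the mixture over \<open>K\<close> telescope to \<open>tail_prod k\<close>, the probability that \<open>K < k\<close>, times the
law obtained by sampling the first \<open>k\<close> cells.\<close>
lemma output_LIMSEQ:
  "(\<lambda>k. tail_prod k * pmf (run_below k) \<Lambda>) \<longlonglongrightarrow> pmf (unbounded_schur_sample w a b) \<Lambda>"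
proof -
  let ?f = "\<lambda>n. case n of 0 \<Rightarrow> run_below 0 | Suc k \<Rightarrow> run_from k"
  have partial: "(\<Sum>n<Suc k. pmf start_pmf n * pmf (?f n) \<Lambda>) = tail_prod k * pmf (run_below k) \<Lambda>" for k
  proof (induction k)
    case (Suc k)
    have "(\<Sum>n<Suc (Suc k). pmf start_pmf n * pmf (?f n) \<Lambda>) =
        tail_prod k * pmf (run_below k) \<Lambda> + start_mass (Suc k) * pmf (run_from k) \<Lambda>"
      using Suc by (simp add: pmf_start_pmf)
    also have "\<dots> = tail_prod (Suc k) * pmf (run_below (Suc k)) \<Lambda>"
      unfolding pmf_run_below_Suc tail_prod_Suc[of k]
      by (simp add: start_mass_def cell_prob_def algebra_simps)
    finally show ?case .
  qed (simp add: pmf_start_pmf start_mass_def)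
  have "(\<lambda>k. \<Sum>n<k. pmf start_pmf n * pmf (?f n) \<Lambda>) \<longlonglongrightarrow> pmf (unbounded_schur_sample w a b) \<Lambda>"
    using pmf_bind_nat_sums[of start_pmf ?f \<Lambda>] unfolding sums_def unbounded_schur_sample_eq .
  then show ?thesis unfolding partial[symmetric] by (rule LIMSEQ_Suc)
qed

lemma schur_configs_iff: "\<Lambda> \<in> schur_configs w \<longleftrightarrow> compatible w 0 \<Lambda>"
proof -
  have "(\<forall>k. related (w k) (\<Lambda> (k - 1)) (\<Lambda> k)) \<longleftrightarrow>
      (\<forall>i. related (w (- int i)) (\<Lambda> (- int i - 1)) (\<Lambda> (- int i))) \<and>
      (\<forall>j. related (w (int j + 1)) (\<Lambda> (int j)) (\<Lambda> (int j + 1)))" (is "?l \<longleftrightarrow> ?r")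
  proof
    assume l: ?l
    show ?r
    proof (intro conjI allI)
      fix i show "related (w (- int i)) (\<Lambda> (- int i - 1)) (\<Lambda> (- int i))" using l by blast
    next
      fix j show "related (w (int j + 1)) (\<Lambda> (int j)) (\<Lambda> (int j + 1))"
        using l[rule_format, of "int j + 1"] by simp
    qed
  next
    assume r: ?r
    show ?l
    proof
      fix k show "related (w k) (\<Lambda> (k - 1)) (\<Lambda> k)"
      proof (cases "k \<le> 0")
        case True
        then have "k = - int (nat (- k))" by simp
        then show ?thesis using r by metis
      next
        case False
        then have "k = int (nat (k - 1)) + 1" "k - 1 = int (nat (k - 1))" by simp_all
        then show ?thesis using r by metis
      qed
    qed
  qed
  moreover have "finite {d. \<Lambda> d \<noteq> empty_part} \<longleftrightarrow> (\<exists>N. \<forall>i. \<bar>i\<bar> > N \<longrightarrow> \<Lambda> i = empty_part)"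
  proof
    assume "finite {d. \<Lambda> d \<noteq> empty_part}"
    then have fin: "finite (abs ` {d. \<Lambda> d \<noteq> empty_part})" by simp
    have "\<Lambda> i = empty_part" if "\<bar>i\<bar> > Max (insert 0 (abs ` {d. \<Lambda> d \<noteq> empty_part}))" for i
    proof (rule ccontr)
      assume "\<Lambda> i \<noteq> empty_part"
      then have "\<bar>i\<bar> \<le> Max (insert 0 (abs ` {d. \<Lambda> d \<noteq> empty_part}))"
        using fin by (intro Max_ge) auto
      then show False using that by simp
    qed
    then show "\<exists>N. \<forall>i. \<bar>i\<bar> > N \<longrightarrow> \<Lambda> i = empty_part" by blast
  next
    assume "\<exists>N. \<forall>i. \<bar>i\<bar> > N \<longrightarrow> \<Lambda> i = empty_part"
    then obtain N where "\<And>i. \<bar>i\<bar> > N \<Longrightarrow> \<Lambda> i = empty_part" by blast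
    then have "{d. \<Lambda> d \<noteq> empty_part} \<subseteq> {- N..N}" by force
    then show "finite {d. \<Lambda> d \<noteq> empty_part}" by (rule finite_subset) simp
  qed
  ultimately show ?thesis
    by (auto simp: schur_configs_def compatible_def row_edge_def col_edge_def)
qed

lemma confined_0: "confined m 0 \<Lambda> \<longleftrightarrow> (\<forall>d. \<bar>d\<bar> > int m \<longrightarrow> \<Lambda> d = empty_part)"
proof -
  have "d < row_edge 0 m \<or> d > col_edge 0 m \<longleftrightarrow> \<bar>d\<bar> > int m" for d
    by (auto simp: row_edge_def col_edge_def)
  then show ?thesis by (simp add: confined_def)
qed

lemma schur_weight_eq:
  assumes "confined m 0 \<Lambda>" "m < n" shows "schur_weight a b \<Lambda> = path_weight a b n 0 \<Lambda>"
proof -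
  have e: "\<Lambda> d = empty_part" if "\<bar>d\<bar> > int m" for d using assms(1) that by (simp add: confined_0)
  have "(\<Prod>i. a i ^ (weight (\<Lambda> (- int i)) - weight (\<Lambda> (- int i - 1)))) =
      (\<Prod>i<n. a i ^ (weight (\<Lambda> (- int i)) - weight (\<Lambda> (- int i - 1))))"
    by (rule prodinf_finite) (use assms(2) e in auto)
  moreover have "(\<Prod>j. b j ^ (weight (\<Lambda> (int j)) - weight (\<Lambda> (int j + 1)))) =
      (\<Prod>j<n. b j ^ (weight (\<Lambda> (int j)) - weight (\<Lambda> (int j + 1))))"
    by (rule prodinf_finite) (use assms(2) e in auto)
  ultimately show ?thesis
    by (simp add: schur_weight_def path_weight_def row_edge_def col_edge_def)
qed

text \<open>On a fixed configuration the converging sequence of \<open>output_LIMSEQ\<close> is eventually constant.\<close>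
lemma pmf_output:
  "pmf (unbounded_schur_sample w a b) \<Lambda> =
     (if \<Lambda> \<in> schur_configs w then tail_prod 0 * schur_weight a b \<Lambda> else 0)"
proof (rule LIMSEQ_unique[OF output_LIMSEQ])
  show "(\<lambda>k. tail_prod k * pmf (run_below k) \<Lambda>) \<longlonglongrightarrow>
      (if \<Lambda> \<in> schur_configs w then tail_prod 0 * schur_weight a b \<Lambda> else 0)"
  proof (rule tendsto_eventually, cases "\<Lambda> \<in> schur_configs w")
    case True
    then have comp: "compatible w 0 \<Lambda>" by (simp add: schur_configs_iff)
    obtain N where N: "\<And>i. \<bar>i\<bar> > N \<Longrightarrow> \<Lambda> i = empty_part"
      using True by (auto simp: schur_configs_def)
    define m where "m = nat N"
    have conf: "confined m 0 \<Lambda>" using N by (auto simp: confined_0 m_def)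
    have "tail_prod k * pmf (run_below k) \<Lambda> = tail_prod 0 * schur_weight a b \<Lambda>"
      if "k > cell_index (m, m)" for k
    proof -
      have "has_path_law m k 0 (\<Prod>l<k. 1 - cell_prob l) (run_below k)"
        using seq_chain_law[OF that] by (simp add: run_below_def cell_prob_def)
      then have "pmf (run_below k) \<Lambda> = (\<Prod>l<k. 1 - cell_prob l) * path_weight a b k 0 \<Lambda>"
        using comp conf by (simp add: has_path_law_def)
      moreover have "m < k" using that cell_le(1)[of "cell_index (m, m)" m m] by simp
      ultimately show ?thesis
        using schur_weight_eq[OF conf] tail_prod_0[of k] by simp
    qed
    then show "\<forall>\<^sub>F k in sequentially. tail_prod k * pmf (run_below k) \<Lambda> =
        (if \<Lambda> \<in> schur_configs w then tail_prod 0 * schur_weight a b \<Lambda> else 0)"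
      using True by (auto intro: eventually_mono[OF eventually_gt_at_top[of "cell_index (m, m)"]])
  next
    case False
    have "pmf (run_below k) \<Lambda> = 0" if "k > cell_index (0, 0)" for k
    proof -
      have "has_path_law 0 k 0 (\<Prod>l<k. 1 - cell_prob l) (run_below k)"
        using seq_chain_law[OF that] by (simp add: run_below_def cell_prob_def)
      then show ?thesis
        using False by (auto simp: has_path_law_def schur_configs_iff set_pmf_iff)
    qed
    then show "\<forall>\<^sub>F k in sequentially. tail_prod k * pmf (run_below k) \<Lambda> =
        (if \<Lambda> \<in> schur_configs w then tail_prod 0 * schur_weight a b \<Lambda> else 0)"
      using False by (auto intro: eventually_mono[OF eventually_gt_at_top[of "cell_index (0, 0)"]])
  qed
qed

text \<open>The output is a probability law, and by \<open>pmf_output\<close> it is a multiple of the Schur weight.\<close>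
lemma schur_weight_has_sum: "(schur_weight a b has_sum (1 / tail_prod 0)) (schur_configs w)"
proof -
  have "(pmf (unbounded_schur_sample w a b) has_sum 1) (schur_configs w)"
    using has_sum_pmf[of "unbounded_schur_sample w a b"]
    by (rule has_sum_cong_neutral[THEN iffD1, rotated -1]) (auto simp: pmf_output)
  then have scaled: "((\<lambda>\<Lambda>. (1 / tail_prod 0) * pmf (unbounded_schur_sample w a b) \<Lambda>) has_sum
      (1 / tail_prod 0) * 1) (schur_configs w)"
    by (rule has_sum_cmult_right)
  have eq: "(1 / tail_prod 0) * pmf (unbounded_schur_sample w a b) \<Lambda> = schur_weight a b \<Lambda>"
    if "\<Lambda> \<in> schur_configs w" for \<Lambda>
    using that tail_prod_pos[of 0] by (simp add: pmf_output)
  show ?thesis using iffD1[OF has_sum_cong[OF eq] scaled] by simp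
qed

end

theorem proposition5p1:
  fixes w :: "int \<Rightarrow> letter" and a b :: "nat \<Rightarrow> real"
  assumes "\<And>k. k \<le> 0 \<Longrightarrow> w k \<in> {Prec, Prec'}"
    and "\<And>k. k \<ge> 1 \<Longrightarrow> w k \<in> {Succ, Succ'}"
    and "\<And>i. a i \<ge> 0" and "\<And>i. b i \<ge> 0"
    and "summable (\<lambda>i. a i + b i)"
    and "\<And>i j. (w (- int i), w (int j + 1)) \<in> {(Prec, Succ), (Prec', Succ')} \<Longrightarrow> a i * b j < 1"
  shows "schur_weight a b summable_on schur_configs w \<and>
    (\<Sum>\<^sub>\<infinity>\<Lambda>\<in>schur_configs w. schur_weight a b \<Lambda>) > 0 \<and>
    unbounded_schur_sample w a b = pyramidal_schur_process w a b"
proof -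
  interpret pyramid w a b by (rule pyramid.intro) (fact assms)+
  have total: "(\<Sum>\<^sub>\<infinity>\<Lambda>\<in>schur_configs w. schur_weight a b \<Lambda>) = 1 / tail_prod 0"
    by (rule infsumI[OF schur_weight_has_sum])
  have "pyramidal_schur_process w a b = embed_pmf (pmf (unbounded_schur_sample w a b))"
    unfolding pyramidal_schur_process_def total
    by (rule arg_cong[where f = embed_pmf]) (auto simp: fun_eq_iff pmf_output)
  then show ?thesis
    using schur_weight_has_sum tail_prod_pos[of 0]
    by (auto simp: total embed_pmf_pmf summable_on_def)
qed

end
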